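(* Let $\alpha>0$ be such that $\mathfrak A(\alpha,e,\eta)<\infty$, where $$\mathfrak A(\alpha,e,\eta)=\frac{2}{4+\alpha}\left\langle\left(\frac{1+\tilde e}{2}\right)^{2+\alpha}+\frac{1-\left|\frac{1-\tilde e}{2}\right|^{4+\alpha}}{1-\left|\frac{1-\tilde e}{2}\right|^{2}}\right\rangle.$$ Let $f_1$ and $f_2$ be two solutions to $$\frac{\partial f}{\partial t}=\tilde Q_e(f,f)$$ corresponding to initial values $f_1^0$, $f_2^0$ with equal moments up to $2+[\alpha]$. Then, for all $t\ge0$, $$d_{2+\alpha}(f_1(t),f_2(t))\le d_{2+\alpha}(f_1^0,f_2^0)\,e^{-C(\alpha,e,\eta)t},\qquad C(\alpha,e,\eta)=1-\mathfrak A(\alpha,e,\eta).$$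
   Context: Initial values are Borel probability measures on $\mathbb R^3$ (written as densities $f(v)\,dv$ even if not absolutely continuous); $[\alpha]$ is the integer part of $\alpha$; equal moments up to order $n$ means that the moments $\int v^\kappa df$ exist and coincide for all multi-indices $\kappa$ with $|\kappa|\le n$. Let $0\le e\le 1$ and let $\eta$ be a real random variable with law a probability measure $\mu$ supported in $[-e,\infty)$, with $\langle\eta\rangle=0$ and $\langle\eta^2\rangle=\beta^2$, where $\langle\cdot\rangle$ denotes expectation with respect to $\eta$ (integration against $\mu$). Put $\tilde e=e+\eta\ge0$. In the formula for $\mathfrak A$ the quotient is understood by continuity when $|1-\tilde e|=2$. For $v,w\in\mathbb R^3$, $\sigma\in S^2$, the post-collision velocity is $$v'=\tfrac12(v+w)+\tfrac{1-\tilde e}{4}(v-w)+\tfrac{1+\tilde e}{4}|v-w|\sigma .$$ The collision operator is defined weakly by $$(\varphi,\tilde Q_e(f,f))=\frac1{4\pi}\Big\langle\int_{\mathbb R^3}\int_{\mathbb R^3}\int_{S^2} f(v)f(w)\,[\varphi(v')-\varphi(v)]\,d\sigma\,dv\,dw\Big\rangle$$ for test functions $\varphi$ (e.g. bounded continuous). A solution is a time-dependent probability measure $f(t)$ satisfying $\frac{d}{dt}\int\varphi f(t)=(\varphi,\tilde Q_e(f(t),f(t)))$ for all such $\varphi$, with the prescribed initial value. With $\hat f(k)=\int e^{-iv\cdot k}\,df(v)$, the Fourier-based metric is, for $s>0$, $d_s(f,g)=\sup_{k\in\mathbb R^3\setminus\{0\}}\dfrac{|\hat f(k)-\hat g(k)|}{|k|^s}$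 (possibly $+\infty$). *)

theory Defs
  imports "HOL-Probability.Probability"
begin

definition borel_prob :: "'a::topological_space measure \<Rightarrow> bool" where
  "borel_prob M \<longleftrightarrow> prob_space M \<and> sets M = sets borel"

(* Surface measure d sigma on the unit sphere (total mass 4 pi in dimension 3), as a Borel
   measure on the ambient space concentrated on the sphere: the area of A is DIM('a) times the
   Lebesgue measure of the cone {x. 0 < |x| < 1, x/|x| in A}, i.e. polar coordinates. *)
definition sphere_measure :: "'a::euclidean_space measure" where
  "sphere_measure = scale_measure (of_nat DIM('a))
     (distr (restrict_space lborel (ball 0 1 - {0})) borel (\<lambda>x. x /\<^sub>R norm x))"

lemma emeasure_sphere_measure: "emeasure (sphere_measure :: (real^3) measure) (sphere 0 1) = ennreal (4*pi)"
proof -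
  let ?B = "ball 0 1 - {0} :: (real^3) set"
  have B: "?B \<in> sets lborel" by auto
  have m: "(\<lambda>x::real^3. x /\<^sub>R norm x) \<in> measurable (restrict_space lborel ?B) borel"
    by (intro measurable_restrict_space1) measurable
  have "(\<lambda>x::real^3. x /\<^sub>R norm x) -` sphere 0 1 \<inter> ?B = ?B" by auto
  then have "emeasure (sphere_measure :: (real^3) measure) (sphere 0 1) = 3 * emeasure lborel ?B"
    unfolding sphere_measure_def using B m
    by (simp add: emeasure_distr emeasure_restrict_space space_restrict_space)
  also have "emeasure lborel ?B = emeasure lborel (ball 0 1 :: (real^3) set)"
    by (subst emeasure_Diff) (auto)
  also have "\<dots> = unit_ball_vol (real 3)" by (subst emeasure_ball) auto
  also have "unit_ball_vol (real 3) = 4/3*pi" by (simp add: unit_ball_vol_3)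
  finally show ?thesis by (simp add: ennreal_mult'[symmetric] flip: ennreal_numeral)
qed

definition post_velocity :: "real \<Rightarrow> real^3 \<Rightarrow> real^3 \<Rightarrow> real^3 \<Rightarrow> real^3" where
  "post_velocity r v w \<sigma> =
     (1/2) *\<^sub>R (v + w) + ((1 - r) / 4) *\<^sub>R (v - w) + ((1 + r) / 4 * norm (v - w)) *\<^sub>R \<sigma>"

(* The pairing of phi with the collision operator; mu is the law of the noise eta, and the
   restitution coefficient is e + eta. *)
definition collision :: "real \<Rightarrow> real measure \<Rightarrow> (real^3 \<Rightarrow> real) \<Rightarrow> (real^3) measure \<Rightarrow> real" where
  "collision e \<mu> \<phi> f = 1 / (4 * pi) *
     (\<integral>\<eta>. (\<integral>w. (\<integral>v. (\<integral>\<sigma>. \<phi> (post_velocity (e + \<eta>) v w \<sigma>) - \<phi> v \<partial>sphere_measure) \<partial>f) \<partial>f) \<partial>\<mu>)"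

(* At t = 0 the time derivative is one-sided; values f t with t < 0 play no role. *)
definition weak_solution ::
  "real \<Rightarrow> real measure \<Rightarrow> (real^3) measure \<Rightarrow> (real \<Rightarrow> (real^3) measure) \<Rightarrow> bool" where
  "weak_solution e \<mu> f0 f \<longleftrightarrow>
     f 0 = f0 \<and>
     (\<forall>t\<ge>0. borel_prob (f t)) \<and>
     (\<forall>\<phi> :: real^3 \<Rightarrow> real. continuous_on UNIV \<phi> \<and> bounded (range \<phi>) \<longrightarrow>
        (\<forall>t\<ge>0. ((\<lambda>s. \<integral>v. \<phi> v \<partial>f s) has_real_derivative collision e \<mu> \<phi> (f t)) (at t within {0..})))"

definition monomial :: "('n::finite \<Rightarrow> nat) \<Rightarrow> real^'n \<Rightarrow> real" where
  "monomial \<kappa> v = (\<Prod>i\<in>UNIV. (v $ i) ^ \<kappa> i)"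

definition equal_moments :: "nat \<Rightarrow> (real^3) measure \<Rightarrow> (real^3) measure \<Rightarrow> bool" where
  "equal_moments n f g \<longleftrightarrow> (\<forall>\<kappa>. (\<Sum>i\<in>UNIV. \<kappa> i) \<le> n \<longrightarrow>
     integrable f (monomial \<kappa>) \<and> integrable g (monomial \<kappa>) \<and>
     (\<integral>v. monomial \<kappa> v \<partial>f) = (\<integral>v. monomial \<kappa> v \<partial>g))"

definition fourier :: "(real^3) measure \<Rightarrow> real^3 \<Rightarrow> complex" where
  "fourier f k = (\<integral>v. exp (- (\<i> * complex_of_real (v \<bullet> k))) \<partial>f)"

definition fourier_dist :: "real \<Rightarrow> (real^3) measure \<Rightarrow> (real^3) measure \<Rightarrow> ennreal" where
  "fourier_dist s f g = (SUP k \<in> UNIV - {0}. ennreal (cmod (fourier f k - fourier g k) / norm k powr s))"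

(* (1 - r^(4+alpha)) / (1 - r^2) for r >= 0, extended by continuity at r = 1. *)
definition ext_quot :: "real \<Rightarrow> real \<Rightarrow> real" where
  "ext_quot \<alpha> r = (if r = 1 then (4 + \<alpha>) / 2 else (1 - r powr (4 + \<alpha>)) / (1 - r\<^sup>2))"

lemma isCont_ext_quot: "isCont (ext_quot \<alpha>) 1"
proof -
  have "((\<lambda>r. (1 - r powr (4 + \<alpha>)) / (1 - r\<^sup>2)) \<longlongrightarrow> (4 + \<alpha>) / 2) (at 1)"
  proof (rule lhopital)
    show "((\<lambda>r. - ((4 + \<alpha>) * r powr (3 + \<alpha>)) / (- 2 * r)) \<longlongrightarrow> (4 + \<alpha>) / 2) (at 1)"
      by (rule tendsto_eq_intros refl | simp add: field_simps)+
    have ev: "\<forall>\<^sub>F r::real in at 1. 0 < r"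
      using order_tendstoD(1)[OF tendsto_ident_at, of 0 "1::real" UNIV] by simp
    show "\<forall>\<^sub>F r in at 1. ((\<lambda>r. 1 - r powr (4 + \<alpha>)) has_real_derivative - ((4 + \<alpha>) * r powr (3 + \<alpha>))) (at r)"
      using ev by eventually_elim (auto intro!: derivative_eq_intros)
    show "\<forall>\<^sub>F r::real in at 1. - 2 * r \<noteq> 0"
      using ev by eventually_elim auto
    have "\<forall>\<^sub>F r::real in at 1. 0 < r \<and> r \<noteq> 1"
      using ev by (simp add: eventually_conj_iff eventually_neq_at_within)
    then show "\<forall>\<^sub>F r::real in at 1. 1 - r\<^sup>2 \<noteq> 0"
      by eventually_elim (auto simp: power2_eq_1_iff)
    show "\<forall>\<^sub>F r::real in at 1. ((\<lambda>r. 1 - r\<^sup>2) has_real_derivative - 2 * r) (at r)"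
      by (rule always_eventually) (auto intro!: derivative_eq_intros)
  qed (auto intro!: tendsto_eq_intros)
  then have "(ext_quot \<alpha> \<longlongrightarrow> (4 + \<alpha>) / 2) (at 1)"
    by (rule Lim_transform_eventually)
      (auto simp: ext_quot_def eventually_at_filter)
  then show ?thesis
    by (simp add: isCont_def ext_quot_def)
qed

(* The integrand is nonnegative mu-almost everywhere, as e + eta >= 0 there. *)
definition frakA :: "real \<Rightarrow> real \<Rightarrow> real measure \<Rightarrow> ennreal" where
  "frakA \<alpha> e \<mu> = ennreal (2 / (4 + \<alpha>)) *
     (\<integral>\<^sup>+ \<eta>. ennreal (((1 + (e + \<eta>)) / 2) powr (2 + \<alpha>) + ext_quot \<alpha> \<bar>(1 - (e + \<eta>)) / 2\<bar>) \<partial>\<mu>)"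

definition rateC :: "real \<Rightarrow> real \<Rightarrow> real measure \<Rightarrow> real" where
  "rateC \<alpha> e \<mu> = 1 - enn2real (frakA \<alpha> e \<mu>)"

end

theory Submission
  imports Defs
begin

text \<open>
On the Fourier side the equation is explicit. By Bobylev's identity the Fourier transform of a solution
satisfies
\[ \partial_t \hat f(k) + \hat f(k) =
   \Big\langle \frac{1}{4\pi} \int_{S^2} \hat f(k_+)\, \hat f(k_-)\, d\sigma \Big\rangle, \]
where $k_+$ and $k_-$ depend on $k$, $\sigma$ and the restitution coefficient (\<open>collision_plane_wave\<close>,
\<open>fourier_weak_solution_has_derivative\<close>). Since $|\hat f| \le 1$, the difference $u$ of the transforms of two
solutions satisfies $|\partial_t u + u| \le L|u|$, where the linear operator $L$ averages
$|u(k_+)| + |u(k_-)|$ over $\sigma$ and the noise.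

The operator $L$ is positive and acts on two functions explicitly: it multiplies constants by 2, and it
multiplies $|k|^{2+\alpha}$ by exactly $\mathfrak A(\alpha,e,\eta)$. The latter holds because $|k_\pm|^2$ is
affine in the height of $\sigma$ over the axis of $k$, and this height is uniformly distributed by the
hat-box theorem of Archimedes (\<open>sphere_measure_height_distribution\<close>, \<open>integral_sphere_norm_powr\<close>,
\<open>norm_mean_gain_diff_le\<close>).

If the initial distance is a finite number $D$, then $|u| \le D |k|^{2+\alpha}$ at time 0, and a direct Gronwall
argument for the distance would give the factor $e^{(\mathfrak A - 1)t}$. It would need that the distance
stays finite, which is not known beforehand. Instead the trivial bound $|u| \le 2$ is fed into a Picard
iteration (\<open>norm_fourier_diff_picard\<close>): after $n$ steps
\[ e^t |u(t,k)| \le D |k|^{2+\alpha} e^{\mathfrak A t} + 2 e^T \frac{(2t)^n}{n!}, \qquad 0 \le t \le T, \]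
and the error term vanishes as $n$ grows. If the initial distance is infinite, then so is the right-hand
side of the claim.
\<close>

section \<open>Volume of the solid spherical cap in three-space\<close>

lemma continuous_on_vector_3:
  fixes f g h :: "'a::topological_space \<Rightarrow> real"
  assumes "continuous_on S f" "continuous_on S g" "continuous_on S h"
  shows "continuous_on S (\<lambda>x. vector [f x, g x, h x] :: real^3)"
proof -
  have "continuous_on S (\<lambda>x. \<chi> i. (vector [f x, g x, h x] :: real^3) $ i)"
  proof (rule continuous_on_vec_lambda)
    show "continuous_on S (\<lambda>x. (vector [f x, g x, h x] :: real^3) $ i)" for i
      using exhaust_3[of i] assms by auto
  qed
  then show ?thesis by simp
qed

lemma measurable_real_complex_to_real3 [measurable]:
  "(\<lambda>p::real \<times> complex. vector [fst p, Re (snd p), Im (snd p)] :: real^3) \<in> borel_measurable borel"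
  by (intro borel_measurable_continuous_onI continuous_on_vector_3 continuous_intros)

text \<open>Splitting off one coordinate allows slicing by planes. The slices live in the complex plane, a Euclidean
space in which they are balls.\<close>
lemma lborel_real3_eq_distr:
  "lborel = distr (lborel :: (real \<times> complex) measure) borel
     (\<lambda>p. vector [fst p, Re (snd p), Im (snd p)] :: real^3)" (is "_ = distr _ _ ?T")
proof (rule lborel_eqI)
  fix l u :: "real^3"
  assume "\<And>b. b \<in> Basis \<Longrightarrow> l \<bullet> b \<le> u \<bullet> b"
  then have le: "l $ i \<le> u $ i" for i
    by (metis axis_in_Basis_iff inner_axis inner_real_def mult.right_neutral Basis_real_def singletonI)
  have "?T -` box l u = box (l$1) (u$1) \<times> box (Complex (l$2) (l$3)) (Complex (u$2) (u$3))"
    by (auto simp: mem_box_cart forall_3 mem_box Basis_complex_def)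
  then have "emeasure (distr lborel borel ?T) (box l u)
      = emeasure (lborel \<Otimes>\<^sub>M lborel) (box (l$1) (u$1) \<times> box (Complex (l$2) (l$3)) (Complex (u$2) (u$3)))"
    by (subst emeasure_distr) (auto simp: lborel_prod)
  also have "\<dots> = ennreal ((u$1 - l$1) * ((u$2 - l$2) * (u$3 - l$3)))"
    using le[of 1] le[of 2] le[of 3]
    by (subst lborel.emeasure_pair_measure_Times)
      (auto simp: emeasure_lborel_box_eq Basis_complex_def inner_diff ennreal_mult' complex_eq_iff)
  also have "(u$1 - l$1) * ((u$2 - l$2) * (u$3 - l$3)) = (\<Prod>b\<in>Basis. (u - l) \<bullet> b)"
  proof -
    have B: "(Basis :: (real^3) set) = (\<lambda>i. axis i 1) ` UNIV"
      by (auto simp: Basis_vec_def)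
    have "(\<Prod>b\<in>Basis. (u - l) \<bullet> b) = (\<Prod>i\<in>UNIV. (u - l) $ i)"
      unfolding B by (subst prod.reindex) (auto simp: inj_on_def axis_eq_axis inner_axis)
    then show ?thesis unfolding UNIV_3 by simp
  qed
  finally show "emeasure (distr lborel borel ?T) (box l u) = ennreal (\<Prod>b\<in>Basis. (u - l) \<bullet> b)" .
qed auto

lemma norm_vector_3: "norm (vector [a, b, c] :: real^3) = sqrt (a\<^sup>2 + (b\<^sup>2 + c\<^sup>2))"
  by (simp add: norm_vec_def L2_set_def sum_3)

text \<open>The slice of the solid cap at height $z$ is a disc. For $z < s$ it is bounded by the cone, with squared
radius $(1/s^2 - 1) z^2$; for $z > s$ it is bounded by the unit ball, with squared radius $1 - z^2$.
Integrating the two areas over $[0,s]$ and $[s,1]$ gives the volume.\<close>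
lemma emeasure_solid_cap:
  fixes s :: real
  assumes s: "0 < s" "s \<le> 1"
  shows "emeasure lborel {x::real^3. norm x < 1 \<and> x \<noteq> 0 \<and> s * norm x \<le> x $ 1} = ennreal (2 * pi * (1 - s) / 3)"
    (is "emeasure _ ?K = _")
proof -
  let ?T = "\<lambda>p::real \<times> complex. vector [fst p, Re (snd p), Im (snd p)] :: real^3"
  \<comment> \<open>The squared slope of the cone: at height \<open>z\<close> its radius squared is \<open>c * z\<^sup>2\<close>.\<close>
  define c where "c = 1 / s\<^sup>2 - 1"
  have c0: "0 \<le> c"
    using s by (auto simp: c_def field_simps power_le_one)
  have nT: "norm (vector [z, Re y, Im y] :: real^3) = sqrt (z\<^sup>2 + (norm y)\<^sup>2)" for z y
    by (simp add: norm_vector_3 cmod_power2)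
  have K: "?K \<in> sets borel" by measurable
  define Q where "Q = {p. norm (?T p) < 1 \<and> ?T p \<noteq> 0 \<and> s * norm (?T p) \<le> ?T p $ 1}"
  have QT: "Q = ?T -` ?K" by (auto simp: Q_def)
  have Q: "Q \<in> sets (lborel \<Otimes>\<^sub>M lborel)"
    unfolding lborel_prod using measurable_sets[OF measurable_real_complex_to_real3 K] by (simp add: QT)
  have mem: "(z, y) \<in> Q \<longleftrightarrow> z > 0 \<and> z\<^sup>2 + (norm y)\<^sup>2 < 1 \<and> (norm y)\<^sup>2 \<le> c * z\<^sup>2" for z y
  proof -
    let ?x = "vector [z, Re y, Im y] :: real^3"
    have Q: "(z, y) \<in> Q \<longleftrightarrow> sqrt (z\<^sup>2 + (norm y)\<^sup>2) < 1 \<and> ?x \<noteq> 0 \<and> s * norm ?x \<le> z"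
      unfolding Q_def mem_Collect_eq fst_conv snd_conv vector_3 nT ..
    show ?thesis
    proof (cases "z > 0")
      case True
      have "s * sqrt (z\<^sup>2 + (norm y)\<^sup>2) \<le> z \<longleftrightarrow> sqrt (z\<^sup>2 + (norm y)\<^sup>2) \<le> z / s"
        using s by (simp add: field_simps)
      also have "\<dots> \<longleftrightarrow> sqrt (z\<^sup>2 + (norm y)\<^sup>2) \<le> sqrt ((z / s)\<^sup>2)"
        using s True by simp
      also have "\<dots> \<longleftrightarrow> (norm y)\<^sup>2 \<le> c * z\<^sup>2"
        unfolding real_sqrt_le_iff by (simp add: c_def power_divide left_diff_distrib) linarith
      finally have le: "s * sqrt (z\<^sup>2 + (norm y)\<^sup>2) \<le> z \<longleftrightarrow> (norm y)\<^sup>2 \<le> c * z\<^sup>2" .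
      have "?x $ 1 \<noteq> 0" using True by simp
      then have "?x \<noteq> 0" by (metis zero_index)
      then show ?thesis
        unfolding Q nT le using True by simp
    next
      case False
      have "\<not> s * norm ?x \<le> z" if "?x \<noteq> 0"
      proof -
        have "0 < s * norm ?x"
          by (metis s(1) mult_pos_pos zero_less_norm_iff that)
        then show ?thesis using False by linarith
      qed
      then show ?thesis
        unfolding Q using False by blast
    qed
  qed
  have disc: "emeasure lborel (cball (0::complex) r) = ennreal (pi * r\<^sup>2)"
             "emeasure lborel (ball (0::complex) r) = ennreal (pi * r\<^sup>2)" if "0 \<le> r" for r
    using that by (simp_all add: emeasure_cball emeasure_ball unit_ball_vol_2)
  have slice: "emeasure lborel (Pair z -` Q) =
      ennreal (pi * c * z\<^sup>2) * indicator {0..s} z + ennreal (pi * (1 - z\<^sup>2)) * indicator {s..1} z" if zs: "z \<noteq> s" for z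
  proof -
    consider "z \<le> 0" | "0 < z" "z < s" | "s < z" "z \<le> 1" | "1 < z"
      using zs by linarith
    then show ?thesis
    proof cases
      case 1
      then have "Pair z -` Q = {}" by (auto simp: mem)
      then show ?thesis using 1 s by (auto simp: indicator_def)
    next
      case 2
      have "z\<^sup>2 + c * z\<^sup>2 < 1"
        using 2 s power_strict_mono[of z s 2] by (simp add: c_def field_simps)
      moreover have "(norm y)\<^sup>2 \<le> c * z\<^sup>2 \<longleftrightarrow> norm y \<le> sqrt (c * z\<^sup>2)" for y :: complex
        using real_sqrt_le_iff[of "(norm y)\<^sup>2" "c * z\<^sup>2"] by simp
      ultimately have "Pair z -` Q = cball 0 (sqrt (c * z\<^sup>2))"
        using 2 by (force simp: mem)
      then show ?thesis using 2 s c0 by (simp add: disc)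
    next
      case 3
      have z1: "0 \<le> 1 - z\<^sup>2" using 3 s by (simp add: power_le_one)
      have cz: "1 \<le> z\<^sup>2 + c * z\<^sup>2"
        using 3 s power_mono[of s z 2] by (simp add: c_def field_simps)
      have "z\<^sup>2 + (norm y)\<^sup>2 < 1 \<longleftrightarrow> norm y < sqrt (1 - z\<^sup>2)" for y :: complex
        using real_sqrt_less_iff[of "(norm y)\<^sup>2" "1 - z\<^sup>2"] by (simp add: algebra_simps)
      then have "Pair z -` Q = ball 0 (sqrt (1 - z\<^sup>2))"
        using 3 s cz by (fastforce simp: mem)
      then show ?thesis using 3 s z1 by (simp add: disc)
    next
      case 4
      then have "1 < z\<^sup>2" using s by (simp add: one_less_power)
      then have "Pair z -` Q = {}" by (auto simp: mem) (smt (verit) zero_le_power2)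
      then show ?thesis using 4 s by (auto simp: indicator_def)
    qed
  qed
  have "emeasure lborel ?K = emeasure (lborel \<Otimes>\<^sub>M lborel) Q"
    using K by (subst lborel_real3_eq_distr, subst emeasure_distr) (auto simp: QT lborel_prod)
  also have "\<dots> = (\<integral>\<^sup>+z. emeasure lborel (Pair z -` Q) \<partial>lborel)"
    using Q by (rule lborel.emeasure_pair_measure_alt)
  also have "\<dots> = (\<integral>\<^sup>+z. ennreal (pi * c * z\<^sup>2) * indicator {0..s} z + ennreal (pi * (1 - z\<^sup>2)) * indicator {s..1} z \<partial>lborel)"
    using AE_lborel_singleton[of s] by (intro nn_integral_cong_AE) (auto simp: slice elim!: eventually_mono)
  also have "\<dots> = (\<integral>\<^sup>+z. ennreal (pi * c * z\<^sup>2) * indicator {0..s} z \<partial>lborel) +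
                  (\<integral>\<^sup>+z. ennreal (pi * (1 - z\<^sup>2)) * indicator {s..1} z \<partial>lborel)"
    by (rule nn_integral_add) auto
  also have "(\<integral>\<^sup>+z. ennreal (pi * c * z\<^sup>2) * indicator {0..s} z \<partial>lborel) = ennreal (pi * c * s^3 / 3 - pi * c * 0^3 / 3)"
    by (rule nn_integral_FTC_Icc) (use s c0 in \<open>auto intro!: derivative_eq_intros\<close>)
  also have "(\<integral>\<^sup>+z. ennreal (pi * (1 - z\<^sup>2)) * indicator {s..1} z \<partial>lborel) = 
      ennreal (pi * (1 - 1^3 / 3) - pi * (s - s^3 / 3))"
    by (rule nn_integral_FTC_Icc)
       (use s in \<open>auto intro!: derivative_eq_intros simp: power_le_one algebra_simps\<close>)
  also have "ennreal (pi * c * s^3 / 3 - pi * c * 0^3 / 3) + ennreal (pi * (1 - 1^3 / 3) - pi * (s - s^3 / 3))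
      = ennreal (pi * c * s^3 / 3 + (pi * (1 - 1^3 / 3) - pi * (s - s^3 / 3)))"
  proof -
    have "0 \<le> (1 - s)\<^sup>2 * (2 + s)" using s by simp
    then have "s - s^3 / 3 \<le> 2/3" by (simp add: power2_eq_square power3_eq_cube algebra_simps)
    then have "pi * (s - s^3 / 3) \<le> pi * (2/3)" by (intro mult_left_mono) auto
    then show ?thesis using s c0 by (subst ennreal_plus) auto
  qed
  also have "pi * c * s^3 / 3 + (pi * (1 - 1^3 / 3) - pi * (s - s^3 / 3)) = 2 * pi * (1 - s) / 3"
    using s by (simp add: c_def field_simps power2_eq_square power3_eq_cube)
  finally show ?thesis .
qed

text \<open>An orthogonal map that takes the first axis to \<open>u\<close> preserves Lebesgue measure and maps one cap
onto the other, so the direction of the axis does not matter.\<close>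
lemma emeasure_solid_cap_rotate:
  fixes u :: "real^3"
  assumes u: "norm u = 1"
  shows "emeasure lborel {x::real^3. norm x < 1 \<and> x \<noteq> 0 \<and> s * norm x \<le> u \<bullet> x} =
    emeasure lborel {x::real^3. norm x < 1 \<and> x \<noteq> 0 \<and> s * norm x \<le> x $ 1}" (is "emeasure _ ?A = emeasure _ ?B")
proof -
  obtain f where f: "orthogonal_transformation f" "f (axis 1 1 :: real^3) = u"
    using orthogonal_transformation_exists_1[of "axis 1 1" u] u by auto
  have fu: "u \<bullet> f x = x $ 1" for x
    using f by (metis cart_eq_inner_axis inner_commute orthogonal_transformation_def)
  have nf: "norm (f x) = norm x" for x
    using f(1) by (rule orthogonal_transformation_norm)
  then have f0: "f x = 0 \<longleftrightarrow> x = 0" for x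
    by (metis norm_eq_zero)
  have "f ` ?B = ?A"
  proof safe
    fix x assume "norm x < 1" "x \<noteq> 0" "s * norm x \<le> u \<bullet> x"
    moreover obtain y where "x = f y"
      using orthogonal_transformation_surj[OF f(1)] by blast
    ultimately show "x \<in> f ` ?B"
      by (auto simp: fu nf f0)
  qed (auto simp: fu nf f0)
  moreover have B: "?B \<in> lmeasurable"
  proof (rule bounded_set_imp_lmeasurable)
    show "bounded ?B" by (rule bounded_subset[OF bounded_ball[of 0 1]]) auto
    have "?B \<in> sets borel" by measurable
    then show "?B \<in> sets lebesgue" by simp
  qed
  moreover have "measure lebesgue (f ` ?B) = measure lebesgue ?B"
    by (rule measure_orthogonal_image[OF f(1) B])
  moreover have "f ` ?B \<in> lmeasurable"
    by (rule measurable_orthogonal_image[OF f(1) B])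
  ultimately have "emeasure lebesgue ?A = emeasure lebesgue ?B"
    using B by (simp add: emeasure_eq_measure2)
  moreover have "?A \<in> sets borel" "?B \<in> sets borel" by measurable
  ultimately show ?thesis
    using emeasure_completion[of ?A lborel] emeasure_completion[of ?B lborel] by simp
qed

section \<open>Surface measure and Archimedes' hat-box theorem\<close>

lemma sets_sphere_measure [measurable_cong, simp]: "sets sphere_measure = sets borel"
  by (simp add: sphere_measure_def sets_scale_measure)

lemma space_sphere_measure [simp]: "space sphere_measure = UNIV"
  by (simp add: sphere_measure_def space_scale_measure)

text \<open>Surface measure is read off from the volume of the cone over a set; this transfers the volumes of solid
caps to areas of spherical caps.\<close>
lemma emeasure_sphere_measure_cone:
  fixes A :: "'a::euclidean_space set"
  assumes [measurable]: "A \<in> sets borel"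
  shows "emeasure sphere_measure A = of_nat DIM('a) * emeasure lborel {x. norm x < 1 \<and> x \<noteq> 0 \<and> x /\<^sub>R norm x \<in> A}"
proof -
  let ?B = "ball 0 1 - {0} :: 'a set"
  have m: "(\<lambda>x::'a. x /\<^sub>R norm x) \<in> measurable (restrict_space lborel ?B) borel"
    by (intro measurable_restrict_space1) measurable
  have "(\<lambda>x. x /\<^sub>R norm x) -` A \<inter> ?B = {x. norm x < 1 \<and> x \<noteq> 0 \<and> x /\<^sub>R norm x \<in> A}"
    by auto
  moreover from this have "{x::'a. norm x < 1 \<and> x \<noteq> 0 \<and> x /\<^sub>R norm x \<in> A} \<subseteq> ?B"
    by auto
  ultimately show ?thesis
    unfolding sphere_measure_def using m
    by (simp add: emeasure_scale_measure emeasure_distr emeasure_restrict_space space_restrict_space)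
qed

lemma AE_sphere_measure_norm: "AE \<sigma> in (sphere_measure :: 'a::euclidean_space measure). norm \<sigma> = 1"
proof (rule AE_I')
  have *: "{x::'a. norm x < 1 \<and> x \<noteq> 0 \<and> x /\<^sub>R norm x \<in> - sphere 0 1} = {}"
    by (auto simp: field_simps)
  have "emeasure sphere_measure (- sphere 0 1 :: 'a set) =
      of_nat DIM('a) * emeasure lborel {x::'a. norm x < 1 \<and> x \<noteq> 0 \<and> x /\<^sub>R norm x \<in> - sphere 0 1}"
    by (rule emeasure_sphere_measure_cone) simp
  then show "- sphere 0 1 \<in> null_sets (sphere_measure :: 'a measure)"
    unfolding * by (simp add: null_sets_def)
qed auto

lemma emeasure_sphere_measure_UNIV: "emeasure (sphere_measure :: (real^3) measure) UNIV = ennreal (4 * pi)"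
proof -
  have "{x::real^3. norm x < 1 \<and> x \<noteq> 0 \<and> x /\<^sub>R norm x \<in> UNIV} = {x. norm x < 1 \<and> x \<noteq> 0 \<and> x /\<^sub>R norm x \<in> sphere 0 1}"
    by auto
  then have "emeasure (sphere_measure :: (real^3) measure) UNIV = emeasure (sphere_measure :: (real^3) measure) (sphere 0 1)"
    by (simp add: emeasure_sphere_measure_cone)
  then show ?thesis by (simp add: emeasure_sphere_measure)
qed

interpretation sphere: finite_measure "sphere_measure :: (real^3) measure"
  by standard (simp add: emeasure_sphere_measure_UNIV)

lemma emeasure_spherical_cap:
  fixes u :: "real^3"
  assumes u: "norm u = 1" and s: "0 < s" "s \<le> 1"
  shows "emeasure sphere_measure {\<sigma>. s \<le> u \<bullet> \<sigma>} = ennreal (2 * pi * (1 - s))"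
proof -
  have "{x. norm x < 1 \<and> x \<noteq> 0 \<and> x /\<^sub>R norm x \<in> {\<sigma>. s \<le> u \<bullet> \<sigma>}} = {x. norm x < 1 \<and> x \<noteq> 0 \<and> s * norm x \<le> u \<bullet> x}"
    by (auto simp: field_simps)
  then have "emeasure sphere_measure {\<sigma>. s \<le> u \<bullet> \<sigma>} = 3 * ennreal (2 * pi * (1 - s) / 3)"
    using emeasure_solid_cap_rotate[OF u, of s] emeasure_solid_cap[OF s]
    by (subst emeasure_sphere_measure_cone) auto
  also have "\<dots> = ennreal (2 * pi * (1 - s))"
    using s by (subst ennreal_numeral[symmetric], subst ennreal_mult'[symmetric]) auto
  finally show ?thesis .
qed

text \<open>The hat-box theorem of Archimedes: the projection of the area of the unit sphere onto an axis is uniform.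
The areas of the caps \<open>s \<le> u \<bullet> \<sigma>\<close> with \<open>s > 0\<close> determine the law of the height on the positive
half-axis. The caps around \<open>- u\<close> are the complements of the sets \<open>x < u \<bullet> \<sigma>\<close> and give the
negative half-axis.\<close>
lemma sphere_measure_height_distribution:
  fixes u :: "real^3"
  assumes u: "norm u = 1"
  shows "distr sphere_measure borel (\<lambda>\<sigma>. u \<bullet> \<sigma>) = density lborel (\<lambda>x. ennreal (2 * pi * indicator {-1..1} x))"
    (is "?M = ?N")
proof (rule measure_eqI_lessThan)
  let ?\<mu> = "measure (sphere_measure :: (real^3) measure)"
  define G where "G = (\<lambda>x. ?\<mu> {\<sigma>. x < u \<bullet> \<sigma>})"
  have cap: "?\<mu> {\<sigma>. s \<le> v \<bullet> \<sigma>} = 2 * pi * (1 - s)" if "norm v = 1" "0 < s" "s \<le> 1" for v s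
    using emeasure_spherical_cap[OF that] that by (simp add: measure_def)
  have tot: "?\<mu> UNIV = 4 * pi"
    by (simp add: measure_def emeasure_sphere_measure_UNIV)
  have compl: "G x = 4 * pi - ?\<mu> {\<sigma>. - x \<le> (- u) \<bullet> \<sigma>}" for x
  proof -
    have "UNIV - {\<sigma>. - x \<le> (- u) \<bullet> \<sigma>} = {\<sigma>. x < u \<bullet> \<sigma>}" by auto
    moreover have "{\<sigma>. - x \<le> (- u) \<bullet> \<sigma>} \<in> sets borel" by measurable
    ultimately show ?thesis
      using sphere.finite_measure_compl[of "{\<sigma>. - x \<le> (- u) \<bullet> \<sigma>}"] by (simp add: tot G_def)
  qed
  have mono: "?\<mu> {\<sigma>. y \<le> v \<bullet> \<sigma>} \<le> ?\<mu> {\<sigma>. x < v \<bullet> \<sigma>}" if "x < y" for x y and v :: "real^3"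
    using that by (intro sphere.finite_measure_mono) auto
  have G_neg: "G x = 2 * pi * (1 - x)" if "-1 \<le> x" "x < 0" for x
    using cap[of "- u" "- x"] u that by (simp add: compl algebra_simps)
  have G_low: "G x = 4 * pi" if "x < -1" for x
  proof -
    have "?\<mu> {\<sigma>. - x \<le> (- u) \<bullet> \<sigma>} \<le> ?\<mu> {\<sigma>. 1 \<le> (- u) \<bullet> \<sigma>}"
      using that by (intro sphere.finite_measure_mono) auto
    then have "?\<mu> {\<sigma>. - x \<le> (- u) \<bullet> \<sigma>} = 0"
      using cap[of "- u" 1] u measure_nonneg[of sphere_measure "{\<sigma>. - x \<le> (- u) \<bullet> \<sigma>}"] by (simp add: measure_le_0_iff)
    then show ?thesis by (simp add: compl)
  qed
  have G_high: "G x = 0" if "1 \<le> x" for x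
  proof -
    have "G x \<le> ?\<mu> {\<sigma>. 1 \<le> u \<bullet> \<sigma>}"
      unfolding G_def using that by (intro sphere.finite_measure_mono) auto
    then show ?thesis
      using cap[of u 1] u measure_nonneg[of sphere_measure "{\<sigma>. x < u \<bullet> \<sigma>}"] unfolding G_def by simp
  qed
  \<comment> \<open>The area formula is for closed caps. Its continuity in the height carries it over to open caps and
    to the equator, where the estimate from above comes from the negative side.\<close>
  have G_pos: "G x = 2 * pi * (1 - x)" if x: "0 \<le> x" "x < 1" for x
  proof (rule antisym)
    show "2 * pi * (1 - x) \<le> G x"
    proof (rule dense_ge)
      fix z assume "G x < z"
      show "2 * pi * (1 - x) \<le> z"
      proof (rule ccontr)
        assume "\<not> 2 * pi * (1 - x) \<le> z"
        then have z: "z < 2 * pi * (1 - x)" by simp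
        \<comment> \<open>The closed cap above height \<open>y\<close> has area \<open>z\<close>.\<close>
        define y where "y = 1 - z / (2 * pi)"
        have "0 \<le> G x" by (simp add: G_def)
        then have "x < y" "y \<le> 1" using z \<open>G x < z\<close> by (auto simp: y_def field_simps)
        then have "2 * pi * (1 - y) \<le> G x"
          using mono[of x y u] cap[of u y] x u by (auto simp: G_def)
        then show False using \<open>G x < z\<close> by (simp add: y_def)
      qed
    qed
    show "G x \<le> 2 * pi * (1 - x)"
    proof (cases "x = 0")
      case False
      have "G x \<le> ?\<mu> {\<sigma>. x \<le> u \<bullet> \<sigma>}"
        unfolding G_def by (intro sphere.finite_measure_mono) auto
      then show ?thesis using False x cap[of u x] u by simp
    next
      case True
      have "G 0 \<le> 2 * pi + e" if "0 < e" for e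
      proof -
        define y where "y = min 1 (e / (2 * pi))"
        have y: "0 < y" "y \<le> 1" "2 * pi * y \<le> e"
          using that by (auto simp: y_def min_def field_simps)
        have "G 0 \<le> G (- y)"
          unfolding G_def using y by (intro sphere.finite_measure_mono) auto
        then show ?thesis using G_neg[of "- y"] y by (simp add: algebra_simps)
      qed
      then show ?thesis using True by (auto intro: field_le_epsilon)
    qed
  qed
  fix x :: real
  have M: "emeasure ?M {x<..} = ennreal (G x)"
    by (subst emeasure_distr) (auto simp: G_def sphere.emeasure_eq_measure vimage_def)
  then show "emeasure ?M {x<..} < \<infinity>" by simp
  have "emeasure ?N {x<..} = (\<integral>\<^sup>+y. ennreal (2 * pi) * indicator ({x<..} \<inter> {-1..1}) y \<partial>lborel)"
    by (subst emeasure_density) (auto intro!: nn_integral_cong split: split_indicator)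
  also have "\<dots> = ennreal (2 * pi) * emeasure lborel ({x<..} \<inter> {-1..1})"
    by (rule nn_integral_cmult_indicator) auto
  also have "\<dots> = ennreal (G x)"
  proof -
    consider "x < -1" | "-1 \<le> x" "x < 1" | "1 \<le> x" by linarith
    then show ?thesis
    proof cases
      case 1
      then have "{x<..} \<inter> {-1..1} = {-1..1}" by auto
      moreover have "ennreal (2 * pi) * 2 = ennreal (4 * pi)"
        by (subst ennreal_numeral[symmetric], subst ennreal_mult'[symmetric]) auto
      ultimately show ?thesis using 1 by (simp add: G_low)
    next
      case 2
      then have "{x<..} \<inter> {-1..1} = {x<..1}" by auto
      then show ?thesis using 2 G_neg[of x] G_pos[of x] by (cases "x < 0") (simp_all add: ennreal_mult'[symmetric])
    next
      case 3
      then have "{x<..} \<inter> {-1..1} = {}" by auto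
      then show ?thesis using 3 by (simp add: G_high)
    qed
  qed
  finally show "emeasure ?M {x<..} = emeasure ?N {x<..}" using M by simp
qed auto

text \<open>The right-hand side depends on \<open>a\<close> only through its norm. This is the form in which rotation
invariance of the sphere enters all later computations.\<close>
lemma integral_sphere_inner:
  fixes a :: "real^3" and h :: "real \<Rightarrow> 'b::{banach, second_countable_topology}"
  assumes [measurable]: "h \<in> borel_measurable borel"
  shows "(\<integral>\<sigma>. h (a \<bullet> \<sigma>) \<partial>sphere_measure) = (2 * pi) *\<^sub>R (LBINT x:{-1..1}. h (norm a * x))"
proof -
  obtain u :: "real^3" where u: "norm u = 1" "a = norm a *\<^sub>R u"
  proof (cases "a = 0")
    case True
    then show ?thesis using that[of "axis 1 1"] by simp
  next
    case False
    then show ?thesis using that[of "a /\<^sub>R norm a"] by simp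
  qed
  have "(\<integral>\<sigma>. h (a \<bullet> \<sigma>) \<partial>sphere_measure) = (\<integral>\<sigma>. h (norm a * (u \<bullet> \<sigma>)) \<partial>sphere_measure)"
    by (subst u(2)) simp
  also have "\<dots> = (\<integral>x. h (norm a * x) \<partial>distr sphere_measure borel (\<lambda>\<sigma>. u \<bullet> \<sigma>))"
    by (subst integral_distr) auto
  also have "\<dots> = (\<integral>x. (2 * pi * indicator {-1..1} x) *\<^sub>R h (norm a * x) \<partial>lborel)"
    unfolding sphere_measure_height_distribution[OF u(1)] by (subst integral_density) auto
  also have "\<dots> = (2 * pi) *\<^sub>R (LBINT x:{-1..1}. h (norm a * x))"
    unfolding set_lebesgue_integral_def by (simp flip: scaleR_scaleR)
  finally show ?thesis .
qed

text \<open>The vectors \<open>norm a *\<^sub>R b\<close> and \<open>norm b *\<^sub>R a\<close> have the same norm. Bobylev's observation rests on this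
identity: it exchanges the roles of the relative velocity and of the Fourier variable.\<close>
lemma integral_sphere_inner_swap:
  fixes a b :: "real^3" and h :: "real \<Rightarrow> 'b::{banach, second_countable_topology}"
  assumes "h \<in> borel_measurable borel"
  shows "(\<integral>\<sigma>. h (norm a * (b \<bullet> \<sigma>)) \<partial>sphere_measure) = (\<integral>\<sigma>. h (norm b * (a \<bullet> \<sigma>)) \<partial>sphere_measure)"
  using integral_sphere_inner[OF assms, of "norm a *\<^sub>R b"] integral_sphere_inner[OF assms, of "norm b *\<^sub>R a"]
  by (simp add: mult.commute)

text \<open>For nonnegative \<open>A\<close> and \<open>B\<close> and positive \<open>q\<close>, the average of \<open>x powr q\<close> over the interval with end
points \<open>A\<close> and \<open>B\<close>, in either order.\<close>
definition powr_mean :: "real \<Rightarrow> real \<Rightarrow> real \<Rightarrow> real" where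
  "powr_mean q A B = (if A = B then A powr q else (A powr (q + 1) - B powr (q + 1)) / ((q + 1) * (A - B)))"

text \<open>The power need not be differentiable where its base vanishes, which can only be at an end point of the
interval. Therefore the fundamental theorem is used in the form that asks for a derivative in the open
interval only.\<close>
lemma has_integral_powr_affine:
  fixes A B q :: real
  assumes A: "0 \<le> A" and B: "0 \<le> B" and q: "0 < q"
  shows "((\<lambda>x. ((A + B) / 2 + (A - B) / 2 * x) powr q) has_integral 2 * powr_mean q A B) {-1..1}"
proof (cases "A = B")
  case True
  have "((\<lambda>x. A powr q) has_integral (1 - (-1)) *\<^sub>R A powr q) {-1..1::real}"
    using has_integral_const_real[of "A powr q" "-1" 1] by simp
  then show ?thesis using True by (simp add: powr_mean_def)
next
  case False
  define F where "F = (\<lambda>x. ((A + B) / 2 + (A - B) / 2 * x) powr (q + 1) / ((q + 1) * ((A - B) / 2)))"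
  have nonneg: "0 \<le> (A + B) / 2 + (A - B) / 2 * x" if "x \<in> {-1..1}" for x
  proof -
    have "0 \<le> A * (1 + x) + B * (1 - x)" using that A B by auto
    then show ?thesis by (simp add: field_simps)
  qed
  have pos: "0 < (A + B) / 2 + (A - B) / 2 * x" if "x \<in> {-1<..<1}" for x
  proof -
    have "0 < A * (1 + x) + B * (1 - x)"
      using that A B False by (cases "A = 0") (auto intro: add_pos_nonneg)
    then show ?thesis by (simp add: field_simps)
  qed
  have "((\<lambda>x. ((A + B) / 2 + (A - B) / 2 * x) powr q) has_integral F 1 - F (-1)) {-1..1}"
  proof (rule fundamental_theorem_of_calculus_interior)
    show "continuous_on {-1..1} F"
      unfolding F_def using False q nonneg
      by (intro continuous_on_divide continuous_on_powr' continuous_intros ballI) auto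
    fix x :: real assume x: "x \<in> {-1<..<1}"
    have "(F has_real_derivative
        ((q + 1) * ((A + B) / 2 + (A - B) / 2 * x) powr q * ((A - B) / 2)) / ((q + 1) * ((A - B) / 2))) (at x)"
      unfolding F_def using pos[OF x]
      by (intro DERIV_cdivide) (auto intro!: derivative_eq_intros simp: field_simps)
    then show "(F has_vector_derivative ((A + B) / 2 + (A - B) / 2 * x) powr q) (at x)"
      using False q by (simp add: has_real_derivative_iff_has_vector_derivative)
  qed simp
  moreover have "F 1 - F (-1) = 2 * powr_mean q A B"
  proof -
    have 1: "(A + B) / 2 + (A - B) / 2 * 1 = A" and 2: "(A + B) / 2 + (A - B) / 2 * (-1) = B"
      by (simp_all add: field_simps)
    have "X / ((q + 1) * (D / 2)) - Y / ((q + 1) * (D / 2)) = 2 * ((X - Y) / ((q + 1) * D))" for X Y D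
      by (simp add: diff_divide_distrib mult.commute[of 2])
    then show ?thesis using False unfolding F_def powr_mean_def 1 2 by simp
  qed
  ultimately show ?thesis by simp
qed

lemma powr_norm_affine_sphere:
  fixes k \<sigma> :: "real^3"
  assumes "norm \<sigma> = 1" "k \<noteq> 0"
  shows "norm (c *\<^sub>R k + (d * norm k) *\<^sub>R \<sigma>) powr p =
    norm k powr p * (((c + d)\<^sup>2 + (c - d)\<^sup>2) / 2 + ((c + d)\<^sup>2 - (c - d)\<^sup>2) / 2 * ((k /\<^sub>R norm k) \<bullet> \<sigma>)) powr (p / 2)"
    (is "norm ?x powr p = _ * ?y powr _")
proof -
  have "(norm ?x)\<^sup>2 = (norm k)\<^sup>2 * ?y"
  proof -
    have "(norm ?x)\<^sup>2 = c\<^sup>2 * (norm k)\<^sup>2 + 2 * c * d * norm k * (k \<bullet> \<sigma>) + d\<^sup>2 * (norm k)\<^sup>2 * (norm \<sigma>)\<^sup>2"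
      unfolding power2_norm_eq_inner
      by (simp add: inner_simps inner_commute dot_square_norm[of k] dot_square_norm[of \<sigma>] power2_eq_square algebra_simps)
    also have "\<dots> = (norm k)\<^sup>2 * ?y"
      using assms by (simp add: power2_eq_square field_simps)
    finally show ?thesis .
  qed
  then have y: "?y = (norm ?x / norm k)\<^sup>2"
    using assms by (simp add: field_simps power2_eq_square)
  have "?y powr (p / 2) = (norm ?x / norm k) powr p"
  proof (cases "norm ?x = 0")
    case True
    then show ?thesis unfolding y by simp
  next
    case False
    then show ?thesis unfolding y using assms
      by (simp add: powr_powr flip: powr_numeral)
  qed
  then show ?thesis using assms by (simp add: powr_divide)
qed

text \<open>The squared norm of \<open>c *\<^sub>R k + (d * norm k) *\<^sub>R \<sigma>\<close> is an affine function of the height of \<open>\<sigma>\<close> over the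
axis of \<open>k\<close>, with the values $(c+d)^2 |k|^2$ and $(c-d)^2 |k|^2$ at the two poles. Since the height is
uniformly distributed, the integral is a mean of powers between these two values.\<close>
lemma integral_sphere_norm_powr:
  fixes k :: "real^3"
  assumes p: "0 < p"
  shows "(\<integral>\<sigma>. norm (c *\<^sub>R k + (d * norm k) *\<^sub>R \<sigma>) powr p \<partial>sphere_measure) =
     4 * pi * norm k powr p * powr_mean (p / 2) ((c + d)\<^sup>2) ((c - d)\<^sup>2)"
proof (cases "k = 0")
  case True
  then show ?thesis using p by simp
next
  case False
  define A where "A = (c + d)\<^sup>2"
  define B where "B = (c - d)\<^sup>2"
  define h where "h = (\<lambda>x::real. norm k powr p * ((A + B) / 2 + (A - B) / 2 * x) powr (p / 2))"
  have hm: "h \<in> borel_measurable borel" unfolding h_def by measurable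
  have AB: "0 \<le> A" "0 \<le> B" by (auto simp: A_def B_def)
  have "(\<integral>\<sigma>. norm (c *\<^sub>R k + (d * norm k) *\<^sub>R \<sigma>) powr p \<partial>sphere_measure) = (\<integral>\<sigma>. h ((k /\<^sub>R norm k) \<bullet> \<sigma>) \<partial>sphere_measure)"
    using AE_sphere_measure_norm
    by (intro integral_cong_AE)
       (auto simp: powr_norm_affine_sphere False h_def A_def B_def elim!: eventually_mono)
  also have "\<dots> = 2 * pi * (LBINT x:{-1..1}. h x)"
    using integral_sphere_inner[OF hm, of "k /\<^sub>R norm k"] False by simp
  also have "(LBINT x:{-1..1}. h x) = norm k powr p * (LBINT x:{-1..1}. ((A + B) / 2 + (A - B) / 2 * x) powr (p / 2))"
    unfolding h_def by simp
  also have "(LBINT x:{-1..1}. ((A + B) / 2 + (A - B) / 2 * x) powr (p / 2)) = 2 * powr_mean (p / 2) A B"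
  proof -
    have "continuous_on {-1..1} (\<lambda>x. ((A + B) / 2 + (A - B) / 2 * x) powr (p / 2))"
    proof (intro continuous_on_powr' continuous_intros ballI)
      fix x :: real assume "x \<in> {-1..1}"
      then have "0 \<le> A * (1 + x) + B * (1 - x)" using AB by auto
      then show "0 \<le> (A + B) / 2 + (A - B) / 2 * x \<and> ((A + B) / 2 + (A - B) / 2 * x = 0 \<longrightarrow> 0 < p / 2)"
        using p by (simp add: field_simps)
    qed
    then have "set_integrable lborel {-1..1} (\<lambda>x. ((A + B) / 2 + (A - B) / 2 * x) powr (p / 2))"
      by (rule borel_integrable_atLeastAtMost')
    from set_borel_integral_eq_integral(2)[OF this] show ?thesis
      using has_integral_powr_affine[OF AB, of "p / 2"] p by (simp add: integral_unique)
  qed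
  finally show ?thesis by (simp add: A_def B_def)
qed

section \<open>Integration against finite measures\<close>

lemma (in finite_measure) integrable_bounded:
  fixes f :: "'a \<Rightarrow> 'b::{banach, second_countable_topology}"
  assumes "f \<in> borel_measurable M" "\<And>x. norm (f x) \<le> B"
  shows "integrable M f"
  using assms by (intro integrable_const_bound[of _ B]) auto

lemma norm_integral_le_integral_AE:
  fixes f :: "'a \<Rightarrow> 'b::{banach, second_countable_topology}"
  assumes "integrable M f" "integrable M g" "AE x in M. norm (f x) \<le> g x"
  shows "norm (\<integral>x. f x \<partial>M) \<le> (\<integral>x. g x \<partial>M)"
proof -
  have "norm (\<integral>x. f x \<partial>M) \<le> (\<integral>x. norm (f x) \<partial>M)"
    by (rule integral_norm_bound)
  also have "\<dots> \<le> (\<integral>x. g x \<partial>M)"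
    using assms by (intro integral_mono_AE) auto
  finally show ?thesis .
qed

lemma measure_sphere_UNIV: "measure (sphere_measure :: (real^3) measure) UNIV = 4 * pi"
  by (simp add: measure_def emeasure_sphere_measure_UNIV)

lemma norm_integral_sphere_le:
  fixes g :: "real^3 \<Rightarrow> complex"
  assumes "\<And>\<sigma>. norm (g \<sigma>) \<le> 1"
  shows "norm (\<integral>\<sigma>. g \<sigma> \<partial>sphere_measure) \<le> 4 * pi"
proof (cases "integrable sphere_measure g")
  case True
  then have "norm (\<integral>\<sigma>. g \<sigma> \<partial>sphere_measure) \<le> (\<integral>\<sigma>. 1 \<partial>(sphere_measure :: (real^3) measure))"
    using assms by (intro norm_integral_le_integral_AE) auto
  then show ?thesis by (simp add: measure_sphere_UNIV)
qed (simp add: not_integrable_integral_eq)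

lemma Fubini_bounded:
  fixes F :: "'a \<Rightarrow> 'b \<Rightarrow> 'c::{banach, second_countable_topology}"
  assumes M: "finite_measure M" and N: "finite_measure N"
    and F: "case_prod F \<in> borel_measurable (M \<Otimes>\<^sub>M N)" and B: "\<And>x y. norm (F x y) \<le> B"
  shows "(\<integral>x. (\<integral>y. F x y \<partial>N) \<partial>M) = (\<integral>y. (\<integral>x. F x y \<partial>M) \<partial>N)"
proof -
  interpret M: finite_measure M by fact
  interpret N: finite_measure N by fact
  interpret P: pair_sigma_finite M N ..
  have "finite_measure (M \<Otimes>\<^sub>M N)"
    by (rule finite_measure_pair_measure[OF N M])
  then have "integrable (M \<Otimes>\<^sub>M N) (\<lambda>(x, y). F x y)"
    using F B by (intro finite_measure.integrable_bounded[of _ _ B]) auto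
  then show ?thesis by (rule P.Fubini_integral[symmetric])
qed

section \<open>The collision operator on the Fourier side\<close>
definition plane_wave :: "real^3 \<Rightarrow> real^3 \<Rightarrow> complex" where
  "plane_wave k v = exp (- (\<i> * complex_of_real (v \<bullet> k)))"

lemma norm_plane_wave [simp]: "norm (plane_wave k v) = 1"
  by (simp add: plane_wave_def norm_exp_eq_Re)

lemma measurable_plane_wave [measurable (raw)]:
  assumes [measurable]: "f \<in> borel_measurable M" "g \<in> borel_measurable M"
  shows "(\<lambda>x. plane_wave (f x) (g x)) \<in> borel_measurable M"
  unfolding plane_wave_def by measurable

lemma fourier_eq: "fourier f k = (\<integral>v. plane_wave k v \<partial>f)"
  by (simp add: fourier_def plane_wave_def)

text \<open>The two Fourier variables into which a collision splits \<open>k\<close>: they sum to \<open>k\<close>, and a plane wave of the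
post-collision velocity, averaged over \<open>\<sigma>\<close>, is the average of the product of plane waves with the
variables \<open>k_plus\<close> and \<open>k_minus\<close> in the two incoming velocities. The factor \<open>- ((1 + r) / 4)\<close> in
\<open>k_minus\<close> is kept apart so that both are of the form \<open>c *\<^sub>R k + (d * norm k) *\<^sub>R \<sigma>\<close>.\<close>
definition k_plus :: "real \<Rightarrow> real^3 \<Rightarrow> real^3 \<Rightarrow> real^3" where
  "k_plus r k \<sigma> = ((3 - r) / 4) *\<^sub>R k + ((1 + r) / 4 * norm k) *\<^sub>R \<sigma>"

definition k_minus :: "real \<Rightarrow> real^3 \<Rightarrow> real^3 \<Rightarrow> real^3" where
  "k_minus r k \<sigma> = ((1 + r) / 4) *\<^sub>R k + (- ((1 + r) / 4) * norm k) *\<^sub>R \<sigma>"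

lemma measurable_k_plus_minus [measurable (raw)]:
  assumes [measurable]: "f \<in> borel_measurable M" "g \<in> borel_measurable M" "h \<in> borel_measurable M"
  shows "(\<lambda>x. k_plus (f x) (g x) (h x)) \<in> borel_measurable M"
    and "(\<lambda>x. k_minus (f x) (g x) (h x)) \<in> borel_measurable M"
  unfolding k_plus_def k_minus_def by measurable

text \<open>The Fourier transform of the gain part of the collision operator at a fixed restitution coefficient.\<close>
definition gain :: "real \<Rightarrow> (real^3) measure \<Rightarrow> real^3 \<Rightarrow> complex" where
  "gain r f k = (\<integral>\<sigma>. fourier f (k_plus r k \<sigma>) * fourier f (k_minus r k \<sigma>) \<partial>sphere_measure) / (4 * pi)"

text \<open>The post-collision velocity depends on \<open>\<sigma>\<close> through $|v-w|\,(k \cdot \sigma)$, the product of plane waves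
through $|k|\,((v-w) \cdot \sigma)$, and otherwise the phases agree. The two integrals coincide by rotation
invariance, although the integrands differ.\<close>
lemma integral_sphere_plane_wave_post_velocity:
  "(\<integral>\<sigma>. plane_wave k (post_velocity r v w \<sigma>) \<partial>sphere_measure) =
   (\<integral>\<sigma>. plane_wave (k_plus r k \<sigma>) v * plane_wave (k_minus r k \<sigma>) w \<partial>sphere_measure)"
proof -
  define h where "h = (\<lambda>x::real. exp (- (\<i> * complex_of_real
    ((1/2) * ((v + w) \<bullet> k) + (1 - r) / 4 * ((v - w) \<bullet> k) + (1 + r) / 4 * x))))"
  have "plane_wave k (post_velocity r v w \<sigma>) = h (norm (v - w) * (k \<bullet> \<sigma>))" for \<sigma>
  proof -
    have "post_velocity r v w \<sigma> \<bullet> k =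
        (1/2) * ((v + w) \<bullet> k) + (1 - r) / 4 * ((v - w) \<bullet> k) + (1 + r) / 4 * (norm (v - w) * (k \<bullet> \<sigma>))"
      unfolding post_velocity_def by (simp only: inner_simps inner_commute[of \<sigma>] mult.assoc)
    then show ?thesis
      unfolding plane_wave_def h_def by simp
  qed
  moreover have "plane_wave (k_plus r k \<sigma>) v * plane_wave (k_minus r k \<sigma>) w = h (norm k * ((v - w) \<bullet> \<sigma>))" for \<sigma>
  proof -
    have "v \<bullet> k_plus r k \<sigma> + w \<bullet> k_minus r k \<sigma> =
        (1/2) * ((v + w) \<bullet> k) + (1 - r) / 4 * ((v - w) \<bullet> k) + (1 + r) / 4 * (norm k * ((v - w) \<bullet> \<sigma>))"
      unfolding k_plus_def k_minus_def by (simp add: inner_simps) (simp add: field_simps)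
    moreover have "plane_wave x v * plane_wave y w = exp (- (\<i> * complex_of_real (v \<bullet> x + w \<bullet> y)))" for x y
      by (simp add: plane_wave_def ring_distribs flip: exp_add)
    ultimately show ?thesis
      by (simp only: h_def)
  qed
  moreover have "(\<integral>\<sigma>. h (norm (v - w) * (k \<bullet> \<sigma>)) \<partial>sphere_measure) = (\<integral>\<sigma>. h (norm k * ((v - w) \<bullet> \<sigma>)) \<partial>sphere_measure)"
    by (rule integral_sphere_inner_swap) (simp add: h_def)
  ultimately show ?thesis by simp
qed

context
  fixes f :: "(real^3) measure"
  assumes f: "borel_prob f"
begin

interpretation prob_space f
  using f by (simp add: borel_prob_def)

lemma sets_borel_prob [measurable_cong]: "sets f = sets borel"
  using f by (simp add: borel_prob_def)

lemma measurable_fourier: "fourier f \<in> borel_measurable borel"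
  unfolding fourier_eq[abs_def] by measurable

lemma integrable_plane_wave: "integrable f (plane_wave k)"
  by (rule integrable_bounded[of _ 1]) (auto intro!: measurable_plane_wave)

lemma norm_fourier_le_1: "norm (fourier f k) \<le> 1"
proof -
  have "norm (fourier f k) \<le> (\<integral>v. norm (plane_wave k v) \<partial>f)"
    unfolding fourier_eq by (rule integral_norm_bound)
  then show ?thesis by (simp add: prob_space)
qed

lemma measurable_fourier_comp [measurable (raw)]:
  "g \<in> borel_measurable N \<Longrightarrow> (\<lambda>x. fourier f (g x)) \<in> borel_measurable N"
  by (rule measurable_compose[OF _ measurable_fourier])

lemma integrable_gain_integrand:
  "integrable sphere_measure (\<lambda>\<sigma>. fourier f (k_plus r k \<sigma>) * fourier f (k_minus r k \<sigma>))"
  using norm_fourier_le_1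
  by (intro sphere.integrable_bounded[of _ 1]) (auto simp: norm_mult intro: mult_le_one)

lemma norm_gain_le_1: "norm (gain r f k) \<le> 1"
proof -
  have "norm (\<integral>\<sigma>. fourier f (k_plus r k \<sigma>) * fourier f (k_minus r k \<sigma>) \<partial>sphere_measure) \<le> 4 * pi"
    using norm_fourier_le_1 by (intro norm_integral_sphere_le) (auto simp: norm_mult intro: mult_le_one)
  then show ?thesis by (simp add: gain_def norm_divide)
qed

lemma measurable_gain [measurable (raw)]:
  assumes [measurable]: "g \<in> borel_measurable N"
  shows "(\<lambda>x. gain (g x) f k) \<in> borel_measurable N"
  unfolding gain_def by measurable

text \<open>Bobylev's identity. With the relative velocity and the Fourier variable exchanged, the integrand is a product of a function of
\<open>v\<close> and a function of \<open>w\<close>, so integrating both against \<open>f\<close> leaves a product of Fourier transforms.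
Test functions are real valued; the real functional \<open>T\<close> covers the real and the imaginary part of the
plane wave at once, and it is moved outwards through one integral after the other.\<close>
lemma collision_plane_wave:
  fixes T :: "complex \<Rightarrow> real"
  assumes T: "bounded_linear T" and \<mu>: "borel_prob \<mu>"
  shows "collision e \<mu> (\<lambda>v. T (plane_wave k v)) f = T ((\<integral>\<eta>. gain (e + \<eta>) f k \<partial>\<mu>) - fourier f k)"
proof -
  interpret T: bounded_linear T by fact
  interpret \<mu>: prob_space \<mu> using \<mu> by (simp add: borel_prob_def)
  have [measurable_cong]: "sets \<mu> = sets borel" using \<mu> by (simp add: borel_prob_def)
  have [measurable]: "(\<lambda>\<sigma>. post_velocity r v w \<sigma>) \<in> borel_measurable borel" for r v w
    unfolding post_velocity_def by measurable
  define W where "W = (\<lambda>r v w \<sigma>. plane_wave (k_plus r k \<sigma>) v * plane_wave (k_minus r k \<sigma>) w)"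
  have W[measurable (raw)]: "(\<lambda>x. W r (a x) (b x) (c x)) \<in> borel_measurable N"
    if [measurable]: "a \<in> borel_measurable N" "b \<in> borel_measurable N" "c \<in> borel_measurable N" for a b c N r
    unfolding W_def by measurable
  have W1: "norm (W r v w \<sigma>) \<le> 1" for r v w \<sigma>
    by (simp add: W_def norm_mult)
  have int_W: "integrable sphere_measure (W r v w)" for r v w
    by (rule sphere.integrable_bounded[OF _ W1]) measurable
  have inner: "(\<integral>\<sigma>. T (plane_wave k (post_velocity r v w \<sigma>)) - T (plane_wave k v) \<partial>sphere_measure) =
      T ((\<integral>\<sigma>. W r v w \<sigma> \<partial>sphere_measure) - 4 * pi * plane_wave k v)" for r v w
  proof -
    have i: "integrable sphere_measure (\<lambda>\<sigma>. plane_wave k (post_velocity r v w \<sigma>))"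
      by (rule sphere.integrable_bounded[of _ 1]) auto
    have "(\<integral>\<sigma>. T (plane_wave k (post_velocity r v w \<sigma>)) - T (plane_wave k v) \<partial>sphere_measure) =
        T (\<integral>\<sigma>. plane_wave k (post_velocity r v w \<sigma>) - plane_wave k v \<partial>sphere_measure)"
      by (subst integral_bounded_linear[OF T, symmetric]) (auto simp: T.diff i)
    also have "\<dots> = T ((\<integral>\<sigma>. W r v w \<sigma> \<partial>sphere_measure) - 4 * pi * plane_wave k v)"
      using i by (simp add: integral_sphere_plane_wave_post_velocity measure_sphere_UNIV scaleR_conv_of_real W_def)
    finally show ?thesis .
  qed
  have middle: "(\<integral>v. T ((\<integral>\<sigma>. W r v w \<sigma> \<partial>sphere_measure) - 4 * pi * plane_wave k v) \<partial>f) =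
      T ((\<integral>\<sigma>. fourier f (k_plus r k \<sigma>) * plane_wave (k_minus r k \<sigma>) w \<partial>sphere_measure) - 4 * pi * fourier f k)" for r w
  proof -
    have i: "integrable f (\<lambda>v. \<integral>\<sigma>. W r v w \<sigma> \<partial>sphere_measure)"
      by (rule integrable_bounded[OF _ norm_integral_sphere_le[OF W1]]) measurable
    have "(\<integral>v. (\<integral>\<sigma>. W r v w \<sigma> \<partial>sphere_measure) \<partial>f) = (\<integral>\<sigma>. (\<integral>v. W r v w \<sigma> \<partial>f) \<partial>sphere_measure)"
      by (rule Fubini_bounded[OF finite_measure_axioms sphere.finite_measure_axioms _ W1]) measurable
    also have "\<dots> = (\<integral>\<sigma>. fourier f (k_plus r k \<sigma>) * plane_wave (k_minus r k \<sigma>) w \<partial>sphere_measure)"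
      by (simp add: W_def fourier_eq)
    finally show ?thesis
      using i integrable_plane_wave
      by (subst integral_bounded_linear[OF T]) (auto simp: fourier_eq)
  qed
  have outer: "(\<integral>w. T ((\<integral>\<sigma>. fourier f (k_plus r k \<sigma>) * plane_wave (k_minus r k \<sigma>) w \<partial>sphere_measure) - 4 * pi * fourier f k) \<partial>f) =
      4 * pi * T (gain r f k - fourier f k)" for r
  proof -
    have b: "norm (fourier f (k_plus r k \<sigma>) * plane_wave (k_minus r k \<sigma>) w) \<le> 1" for \<sigma> w
      by (simp add: norm_mult norm_fourier_le_1)
    have i: "integrable f (\<lambda>w. \<integral>\<sigma>. fourier f (k_plus r k \<sigma>) * plane_wave (k_minus r k \<sigma>) w \<partial>sphere_measure)"
      by (rule integrable_bounded[OF _ norm_integral_sphere_le[OF b]]) measurable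
    have "(\<integral>w. (\<integral>\<sigma>. fourier f (k_plus r k \<sigma>) * plane_wave (k_minus r k \<sigma>) w \<partial>sphere_measure) \<partial>f) =
        (\<integral>\<sigma>. (\<integral>w. fourier f (k_plus r k \<sigma>) * plane_wave (k_minus r k \<sigma>) w \<partial>f) \<partial>sphere_measure)"
      by (rule Fubini_bounded[OF finite_measure_axioms sphere.finite_measure_axioms _ b]) measurable
    also have "\<dots> = 4 * pi * gain r f k"
      by (simp add: gain_def fourier_eq)
    finally have "(\<integral>w. T ((\<integral>\<sigma>. fourier f (k_plus r k \<sigma>) * plane_wave (k_minus r k \<sigma>) w \<partial>sphere_measure) - 4 * pi * fourier f k) \<partial>f) =
        T (4 * pi * gain r f k - 4 * pi * fourier f k)"
      using i by (subst integral_bounded_linear[OF T]) (auto simp: prob_space)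
    also have "\<dots> = T ((4 * pi) *\<^sub>R (gain r f k - fourier f k))"
      by (simp add: scaleR_conv_of_real algebra_simps)
    finally show ?thesis by (simp only: T.scaleR real_scaleR_def)
  qed
  have i: "integrable \<mu> (\<lambda>\<eta>. gain (e + \<eta>) f k)"
    by (rule \<mu>.integrable_bounded[OF _ norm_gain_le_1]) measurable
  have "collision e \<mu> (\<lambda>v. T (plane_wave k v)) f = 1 / (4 * pi) * (\<integral>\<eta>. 4 * pi * T (gain (e + \<eta>) f k - fourier f k) \<partial>\<mu>)"
    unfolding collision_def inner middle outer ..
  also have "\<dots> = (\<integral>\<eta>. T (gain (e + \<eta>) f k - fourier f k) \<partial>\<mu>)"
    by simp
  also have "\<dots> = T (\<integral>\<eta>. gain (e + \<eta>) f k - fourier f k \<partial>\<mu>)"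
    using i by (intro integral_bounded_linear[OF T]) simp
  also have "(\<integral>\<eta>. gain (e + \<eta>) f k - fourier f k \<partial>\<mu>) = (\<integral>\<eta>. gain (e + \<eta>) f k \<partial>\<mu>) - fourier f k"
    using i by (simp add: \<mu>.prob_space)
  finally show ?thesis .
qed

end

text \<open>The real and imaginary parts of plane waves are bounded and continuous, hence admissible test functions.\<close>
lemma fourier_weak_solution_has_derivative:
  assumes sol: "weak_solution e \<mu> f0 f" and \<mu>: "borel_prob \<mu>" and t: "0 \<le> t"
  shows "((\<lambda>s. fourier (f s) k) has_vector_derivative
           (\<integral>\<eta>. gain (e + \<eta>) (f t) k \<partial>\<mu>) - fourier (f t) k) (at t within {0..})"
proof -
  have prob: "borel_prob (f s)" if "0 \<le> s" for s
    using sol that by (simp add: weak_solution_def)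
  have *: "((\<lambda>s. T (fourier (f s) k)) has_real_derivative
      T ((\<integral>\<eta>. gain (e + \<eta>) (f t) k \<partial>\<mu>) - fourier (f t) k)) (at t within {0..})"
    if T: "bounded_linear T" for T :: "complex \<Rightarrow> real"
  proof -
    have "continuous_on UNIV (\<lambda>v. T (plane_wave k v))"
      unfolding plane_wave_def by (intro bounded_linear.continuous_on[OF T] continuous_intros)
    moreover have "bounded (range (\<lambda>v. T (plane_wave k v)))"
    proof -
      obtain K where "\<And>x. norm (T x) \<le> norm x * K"
        using bounded_linear.bounded[OF T] by blast
      then have "norm (T (plane_wave k v)) \<le> K" for v
        by (metis norm_plane_wave mult_1)
      then show ?thesis by (auto simp: bounded_iff)
    qed
    ultimately have "((\<lambda>s. \<integral>v. T (plane_wave k v) \<partial>f s) has_real_derivative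
        collision e \<mu> (\<lambda>v. T (plane_wave k v)) (f t)) (at t within {0..})"
      using sol t unfolding weak_solution_def by blast
    moreover have "(\<integral>v. T (plane_wave k v) \<partial>f s) = T (fourier (f s) k)" if "0 \<le> s" for s
      unfolding fourier_eq by (rule integral_bounded_linear[OF T integrable_plane_wave[OF prob[OF that]]])
    ultimately show ?thesis
      unfolding collision_plane_wave[OF prob[OF t] T \<mu>] has_real_derivative_iff_has_vector_derivative
      using t by (auto elim: has_vector_derivative_transform[rotated 2])
  qed
  show ?thesis
    unfolding has_vector_derivative_complex_iff
    using *[OF bounded_linear_Re] *[OF bounded_linear_Im] by simp
qed

section \<open>The contraction estimate\<close>
definition rate_integrand :: "real \<Rightarrow> real \<Rightarrow> real" where
  "rate_integrand \<alpha> r = 2 / (4 + \<alpha>) * (((1 + r) / 2) powr (2 + \<alpha>) + ext_quot \<alpha> \<bar>(1 - r) / 2\<bar>)"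

lemma measurable_rate_integrand: "rate_integrand \<alpha> \<in> borel_measurable borel"
  unfolding rate_integrand_def[abs_def] ext_quot_def by measurable

lemma powr_of_square: "(x\<^sup>2) powr a = \<bar>x\<bar> powr (2 * a)" for x a :: real
proof (cases "x = 0")
  case False
  then have "x\<^sup>2 = \<bar>x\<bar> powr 2" by (simp add: powr_numeral)
  then show ?thesis by (metis powr_powr)
qed simp

lemma powr_mean_one_square:
  assumes "0 < \<alpha>"
  shows "powr_mean ((2 + \<alpha>) / 2) 1 (x\<^sup>2) = 2 / (4 + \<alpha>) * ext_quot \<alpha> \<bar>x\<bar>"
proof -
  have q: "(2 + \<alpha>) / 2 + 1 = (4 + \<alpha>) / 2" by simp
  have "1 = x\<^sup>2 \<longleftrightarrow> \<bar>x\<bar> = 1"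
    by (auto simp: power2_eq_1_iff abs_if)
  moreover have "(x\<^sup>2) powr ((4 + \<alpha>) / 2) = \<bar>x\<bar> powr (4 + \<alpha>)"
    unfolding powr_of_square by (rule arg_cong) (simp add: field_simps)
  ultimately show ?thesis
    using assms unfolding powr_mean_def ext_quot_def q by (simp add: mult.commute)
qed

lemma powr_mean_zero_square:
  assumes "0 < \<alpha>" "0 < x"
  shows "powr_mean ((2 + \<alpha>) / 2) 0 (x\<^sup>2) = 2 / (4 + \<alpha>) * x powr (2 + \<alpha>)"
proof -
  have q: "(2 + \<alpha>) / 2 + 1 = (4 + \<alpha>) / 2" by simp
  have "(x\<^sup>2) powr ((4 + \<alpha>) / 2) = x powr (2 + (2 + \<alpha>))"
  proof -
    have *: "2 * ((4 + \<alpha>) / 2) = 2 + (2 + \<alpha>)" by (simp add: field_simps)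
    show ?thesis unfolding powr_of_square * using assms by simp
  qed
  also have "\<dots> = x\<^sup>2 * x powr (2 + \<alpha>)"
    using assms by (subst powr_add) (simp add: powr_numeral)
  finally show ?thesis
    using assms unfolding powr_mean_def q by simp
qed

text \<open>This is where the constant in the theorem comes from. Over the two poles, the norm of \<open>k_plus\<close> runs from
$|k|$ to $|1-r|/2 \cdot |k|$ and the norm of \<open>k_minus\<close> from $0$ to $(1+r)/2 \cdot |k|$; the means of their
powers are the two terms of the integrand of \<open>frakA\<close>, including the value by continuity of the quotient.\<close>
lemma integral_sphere_k_plus_minus:
  assumes "0 < \<alpha>" "0 \<le> r"
  shows "(\<integral>\<sigma>. norm (k_plus r k \<sigma>) powr (2 + \<alpha>) \<partial>sphere_measure) + (\<integral>\<sigma>. norm (k_minus r k \<sigma>) powr (2 + \<alpha>) \<partial>sphere_measure)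
    = 4 * pi * norm k powr (2 + \<alpha>) * rate_integrand \<alpha> r"
proof -
  have 1: "(3 - r) / 4 + (1 + r) / 4 = 1" "(3 - r) / 4 - (1 + r) / 4 = (1 - r) / 2"
    "(1 + r) / 4 + - ((1 + r) / 4) = 0" "(1 + r) / 4 - - ((1 + r) / 4) = (1 + r) / 2"
    by (simp_all add: field_simps)
  have "powr_mean ((2 + \<alpha>) / 2) (1\<^sup>2) (((1 - r) / 2)\<^sup>2) + powr_mean ((2 + \<alpha>) / 2) (0\<^sup>2) (((1 + r) / 2)\<^sup>2) = rate_integrand \<alpha> r"
    using powr_mean_one_square[OF assms(1), of "(1 - r) / 2"] powr_mean_zero_square[OF assms(1), of "(1 + r) / 2"] assms
    by (simp add: rate_integrand_def ring_distribs)
  moreover have "0 < 2 + \<alpha>" using assms by simp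
  ultimately show ?thesis
    unfolding k_plus_def k_minus_def integral_sphere_norm_powr[OF \<open>0 < 2 + \<alpha>\<close>] 1
    by (simp flip: distrib_left)
qed

lemma integrable_sphere_norm_powr:
  fixes k :: "real^3"
  assumes p: "0 \<le> p"
  shows "integrable sphere_measure (\<lambda>\<sigma>. norm (c *\<^sub>R k + (d * norm k) *\<^sub>R \<sigma>) powr p)"
proof (rule sphere.integrable_const_bound[where B = "((\<bar>c\<bar> + \<bar>d\<bar>) * norm k) powr p"])
  have "norm (c *\<^sub>R k + (d * norm k) *\<^sub>R \<sigma>) \<le> (\<bar>c\<bar> + \<bar>d\<bar>) * norm k" if "norm \<sigma> = 1" for \<sigma> :: "real^3"
    using norm_triangle_ineq[of "c *\<^sub>R k" "(d * norm k) *\<^sub>R \<sigma>"] that by (simp add: abs_mult algebra_simps)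
  then show "AE \<sigma> in sphere_measure. norm (norm (c *\<^sub>R k + (d * norm k) *\<^sub>R \<sigma>) powr p) \<le> ((\<bar>c\<bar> + \<bar>d\<bar>) * norm k) powr p"
    using AE_sphere_measure_norm p by (auto elim!: eventually_mono intro!: powr_mono2)
  show "(\<lambda>\<sigma>. norm (c *\<^sub>R k + (d * norm k) *\<^sub>R \<sigma>) powr p) \<in> borel_measurable sphere_measure"
    by (subst measurable_cong_sets[OF sets_sphere_measure refl]) measurable
qed

lemma norm_mult_diff_le:
  fixes a b c d :: "'a::real_normed_algebra"
  assumes "norm b \<le> 1" "norm c \<le> 1"
  shows "norm (a * b - c * d) \<le> norm (a - c) + norm (b - d)"
proof -
  have "a * b - c * d = (a - c) * b + c * (b - d)"
    by (simp add: algebra_simps)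
  then have "norm (a * b - c * d) \<le> norm ((a - c) * b) + norm (c * (b - d))"
    by (simp add: norm_triangle_ineq)
  also have "\<dots> \<le> norm (a - c) * norm b + norm c * norm (b - d)"
    by (intro add_mono norm_mult_ineq)
  also have "\<dots> \<le> norm (a - c) * 1 + 1 * norm (b - d)"
    using assms by (intro add_mono mult_mono) auto
  finally show ?thesis by simp
qed

text \<open>Both factors of the gain term have modulus at most 1, so the difference of two products is at most the sum
of the differences of the factors. A power of order \<open>2 + \<alpha>\<close> is reproduced with the factor
\<open>rate_integrand\<close>. The additive constant \<open>b\<close>, which is doubled, is carried along because the distance of
two solutions at positive times is not known in advance to be finite; only the trivial bound 2 on the
difference of two Fourier transforms is.\<close>
lemma norm_gain_diff_le:
  assumes f: "borel_prob f" and g: "borel_prob g" and \<alpha>: "0 < \<alpha>" and r: "0 \<le> r"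
    and le: "\<And>k. norm (fourier f k - fourier g k) \<le> c * norm k powr (2 + \<alpha>) + b"
  shows "norm (gain r f k - gain r g k) \<le> c * norm k powr (2 + \<alpha>) * rate_integrand \<alpha> r + 2 * b"
proof -
  let ?F = "\<lambda>f \<sigma>. fourier f (k_plus r k \<sigma>) * fourier f (k_minus r k \<sigma>)"
  let ?P = "\<lambda>\<sigma>. norm (k_plus r k \<sigma>) powr (2 + \<alpha>)" and ?M = "\<lambda>\<sigma>. norm (k_minus r k \<sigma>) powr (2 + \<alpha>)"
  have P: "integrable sphere_measure ?P" and M: "integrable sphere_measure ?M"
    unfolding k_plus_def k_minus_def using \<alpha> by (simp_all only: integrable_sphere_norm_powr)
  have "norm (\<integral>\<sigma>. ?F f \<sigma> - ?F g \<sigma> \<partial>sphere_measure) \<le> (\<integral>\<sigma>. c * ?P \<sigma> + c * ?M \<sigma> + 2 * b \<partial>sphere_measure)"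
  proof (intro norm_integral_le_integral_AE AE_I2)
    fix \<sigma>
    have "norm (?F f \<sigma> - ?F g \<sigma>) \<le> norm (fourier f (k_plus r k \<sigma>) - fourier g (k_plus r k \<sigma>)) +
        norm (fourier f (k_minus r k \<sigma>) - fourier g (k_minus r k \<sigma>))"
      using norm_fourier_le_1[OF f] norm_fourier_le_1[OF g] by (rule norm_mult_diff_le)
    also have "\<dots> \<le> (c * ?P \<sigma> + b) + (c * ?M \<sigma> + b)"
      by (intro add_mono le)
    finally show "norm (?F f \<sigma> - ?F g \<sigma>) \<le> c * ?P \<sigma> + c * ?M \<sigma> + 2 * b" by simp
  qed (use integrable_gain_integrand[OF f] integrable_gain_integrand[OF g] P M in auto)
  also have "\<dots> = c * ((\<integral>\<sigma>. ?P \<sigma> \<partial>sphere_measure) + (\<integral>\<sigma>. ?M \<sigma> \<partial>sphere_measure)) + 4 * pi * (2 * b)"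
    using P M by (simp add: measure_sphere_UNIV ring_distribs)
  also have "\<dots> = 4 * pi * (c * norm k powr (2 + \<alpha>) * rate_integrand \<alpha> r + 2 * b)"
    unfolding integral_sphere_k_plus_minus[OF \<alpha> r] by (simp add: algebra_simps)
  finally have *: "norm (\<integral>\<sigma>. ?F f \<sigma> - ?F g \<sigma> \<partial>sphere_measure) \<le>
    4 * pi * (c * norm k powr (2 + \<alpha>) * rate_integrand \<alpha> r + 2 * b)" .
  have eq: "gain r f k - gain r g k = (\<integral>\<sigma>. ?F f \<sigma> - ?F g \<sigma> \<partial>sphere_measure) / (4 * pi)"
    unfolding gain_def using integrable_gain_integrand[OF f] integrable_gain_integrand[OF g]
    by (simp add: diff_divide_distrib)
  have "norm (gain r f k - gain r g k) = norm (\<integral>\<sigma>. ?F f \<sigma> - ?F g \<sigma> \<partial>sphere_measure) / (4 * pi)"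
    unfolding eq by (simp add: norm_divide)
  also have "\<dots> \<le> c * norm k powr (2 + \<alpha>) * rate_integrand \<alpha> r + 2 * b"
    using * by (simp add: divide_le_eq mult.commute)
  finally show ?thesis .
qed

lemma ext_quot_nonneg:
  assumes "0 < \<alpha>" "0 \<le> x"
  shows "0 \<le> ext_quot \<alpha> x"
proof -
  consider "x < 1" | "x = 1" | "1 < x" by linarith
  then show ?thesis
  proof cases
    case 1
    then have "x powr (4 + \<alpha>) \<le> 1" "x\<^sup>2 \<le> 1"
      using assms by (auto intro: powr_le1 power_le_one)
    then show ?thesis using assms by (simp add: ext_quot_def)
  next
    case 3
    then have "1 \<le> x powr (4 + \<alpha>)" "1 \<le> x\<^sup>2"
      using assms by (auto intro: ge_one_powr_ge_zero one_le_power)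
    then show ?thesis using 3 by (simp add: ext_quot_def zero_le_divide_iff)
  qed (use assms in \<open>simp add: ext_quot_def\<close>)
qed

lemma rate_integrand_nonneg:
  assumes "0 < \<alpha>"
  shows "0 \<le> rate_integrand \<alpha> r"
  using assms ext_quot_nonneg[of \<alpha> "\<bar>(1 - r) / 2\<bar>"] by (simp add: rate_integrand_def)

lemma rate_integrand_integral:
  assumes \<mu>: "borel_prob \<mu>" and \<alpha>: "0 < \<alpha>" and A: "frakA \<alpha> e \<mu> < \<infinity>"
  shows "integrable \<mu> (\<lambda>\<eta>. rate_integrand \<alpha> (e + \<eta>))"
    and "(\<integral>\<eta>. rate_integrand \<alpha> (e + \<eta>) \<partial>\<mu>) = enn2real (frakA \<alpha> e \<mu>)"
proof -
  have [measurable_cong]: "sets \<mu> = sets borel" using \<mu> by (simp add: borel_prob_def)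
  have m[measurable]: "(\<lambda>\<eta>. rate_integrand \<alpha> (e + \<eta>)) \<in> borel_measurable \<mu>"
    by (rule measurable_compose[OF _ measurable_rate_integrand]) measurable
  have [measurable]: "(\<lambda>\<eta>. ext_quot \<alpha> \<bar>(1 - (e + \<eta>)) / 2\<bar>) \<in> borel_measurable \<mu>"
    unfolding ext_quot_def by measurable
  have eq: "frakA \<alpha> e \<mu> = (\<integral>\<^sup>+\<eta>. ennreal (rate_integrand \<alpha> (e + \<eta>)) \<partial>\<mu>)"
  proof -
    have "frakA \<alpha> e \<mu> = (\<integral>\<^sup>+\<eta>. ennreal (2 / (4 + \<alpha>)) *
        ennreal (((1 + (e + \<eta>)) / 2) powr (2 + \<alpha>) + ext_quot \<alpha> \<bar>(1 - (e + \<eta>)) / 2\<bar>) \<partial>\<mu>)"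
      unfolding frakA_def by (rule nn_integral_cmult[symmetric]) measurable
    also have "\<dots> = (\<integral>\<^sup>+\<eta>. ennreal (rate_integrand \<alpha> (e + \<eta>)) \<partial>\<mu>)"
      unfolding rate_integrand_def by (intro nn_integral_cong ennreal_mult'[symmetric]) (use \<alpha> in simp)
    finally show ?thesis .
  qed
  show "integrable \<mu> (\<lambda>\<eta>. rate_integrand \<alpha> (e + \<eta>))"
    using A rate_integrand_nonneg[OF \<alpha>] unfolding eq by (intro integrableI_nonneg) auto
  show "(\<integral>\<eta>. rate_integrand \<alpha> (e + \<eta>) \<partial>\<mu>) = enn2real (frakA \<alpha> e \<mu>)"
    unfolding eq using rate_integrand_nonneg[OF \<alpha>] by (intro integral_eq_nn_integral) auto
qed

lemma norm_mean_gain_diff_le: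
  assumes \<mu>: "borel_prob \<mu>" and e: "AE \<eta> in \<mu>. - e \<le> \<eta>" and A: "frakA \<alpha> e \<mu> < \<infinity>"
    and f: "borel_prob f" and g: "borel_prob g" and \<alpha>: "0 < \<alpha>"
    and le: "\<And>k. norm (fourier f k - fourier g k) \<le> c * norm k powr (2 + \<alpha>) + b"
  shows "norm ((\<integral>\<eta>. gain (e + \<eta>) f k \<partial>\<mu>) - (\<integral>\<eta>. gain (e + \<eta>) g k \<partial>\<mu>))
    \<le> c * norm k powr (2 + \<alpha>) * enn2real (frakA \<alpha> e \<mu>) + 2 * b"
proof -
  interpret \<mu>: prob_space \<mu> using \<mu> by (simp add: borel_prob_def)
  have [measurable_cong]: "sets \<mu> = sets borel" using \<mu> by (simp add: borel_prob_def)
  have i: "integrable \<mu> (\<lambda>\<eta>. gain (e + \<eta>) h k)" if h: "borel_prob h" for h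
    by (rule \<mu>.integrable_bounded[OF _ norm_gain_le_1[OF h]]) (intro measurable_gain h, measurable)
  note rate = rate_integrand_integral[OF \<mu> \<alpha> A]
  have "norm (\<integral>\<eta>. gain (e + \<eta>) f k - gain (e + \<eta>) g k \<partial>\<mu>) \<le>
      (\<integral>\<eta>. c * norm k powr (2 + \<alpha>) * rate_integrand \<alpha> (e + \<eta>) + 2 * b \<partial>\<mu>)"
  proof (rule norm_integral_le_integral_AE)
    show "AE \<eta> in \<mu>. norm (gain (e + \<eta>) f k - gain (e + \<eta>) g k) \<le> c * norm k powr (2 + \<alpha>) * rate_integrand \<alpha> (e + \<eta>) + 2 * b"
      using e by eventually_elim (intro norm_gain_diff_le f g \<alpha> le, simp)
  qed (use i[OF f] i[OF g] rate in auto)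
  also have "\<dots> = c * norm k powr (2 + \<alpha>) * enn2real (frakA \<alpha> e \<mu>) + 2 * b"
    using rate by (simp add: \<mu>.prob_space)
  finally show ?thesis using i[OF f] i[OF g] by simp
qed

section \<open>Picard iteration and the decay of the distance\<close>

text \<open>Iterating the integral form of the equation. By the previous estimate, a bound
$D |k|^{2+\alpha} e^{at} + M (2t)^n / n!$ on $e^t |\hat f - \hat g|$ bounds the time derivative of
$e^t (\hat f - \hat g)$ by $a D |k|^{2+\alpha} e^{at} + 2 M (2t)^n / n!$, which is the derivative of the bound
with \<open>n\<close> replaced by \<open>n + 1\<close>. The trivial bound 2 starts the induction, with \<open>M = 2 * exp T\<close>. The mean
value inequality for vector valued functions takes the place of integration in time.\<close>
lemma norm_fourier_diff_picard:
  assumes \<mu>: "borel_prob \<mu>" and e: "AE \<eta> in \<mu>. - e \<le> \<eta>" and \<alpha>: "0 < \<alpha>" and A: "frakA \<alpha> e \<mu> < \<infinity>"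
    and f: "weak_solution e \<mu> f0 f" and g: "weak_solution e \<mu> g0 g"
    and d: "\<And>k. norm (fourier f0 k - fourier g0 k) \<le> d * norm k powr (2 + \<alpha>)"
    and t: "0 \<le> t" "t \<le> T"
  shows "exp t * norm (fourier (f t) k - fourier (g t) k) \<le>
    d * norm k powr (2 + \<alpha>) * exp (enn2real (frakA \<alpha> e \<mu>) * t) + 2 * exp T * ((2 * t) ^ n / fact n)"
  using t
proof (induction n arbitrary: t k)
  have prob: "borel_prob (f s)" "borel_prob (g s)" if "0 \<le> s" for s
    using f g that by (simp_all add: weak_solution_def)
  have init: "f 0 = f0" "g 0 = g0"
    using f g by (simp_all add: weak_solution_def)
  have d0: "0 \<le> d * norm k powr (2 + \<alpha>)" for k :: "real^3"
    using d[of k] norm_ge_zero by (rule order_trans[rotated])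
  let ?a = "enn2real (frakA \<alpha> e \<mu>)"
  {
    case 0
    have "norm (fourier (f t) k - fourier (g t) k) \<le> 1 + 1"
      using 0 norm_fourier_le_1 prob by (intro order_trans[OF norm_triangle_ineq4] add_mono) auto
    then have "exp t * norm (fourier (f t) k - fourier (g t) k) \<le> exp T * 2"
      using 0 by (intro mult_mono) auto
    moreover have "0 \<le> d * norm k powr (2 + \<alpha>) * exp (?a * t)"
      using d0 by simp
    ultimately show ?case by simp
  next
    case (Suc n)
    define u where "u = (\<lambda>s. exp s *\<^sub>R (fourier (f s) k - fourier (g s) k))"
    define Q where "Q = (\<lambda>s. (\<integral>\<eta>. gain (e + \<eta>) (f s) k \<partial>\<mu>) - (\<integral>\<eta>. gain (e + \<eta>) (g s) k \<partial>\<mu>))"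
    define \<phi> where "\<phi> = (\<lambda>s. d * norm k powr (2 + \<alpha>) * exp (?a * s) + 2 * exp T * ((2 * s) ^ Suc n / fact (Suc n)))"
    define \<phi>' where "\<phi>' = (\<lambda>s. d * norm k powr (2 + \<alpha>) * (?a * exp (?a * s)) + 2 * exp T * (2 * ((2 * s) ^ n / fact n)))"
    have u': "(u has_vector_derivative exp s *\<^sub>R Q s) (at s within {0..})" if "0 \<le> s" for s
    proof -
      have "(u has_vector_derivative
          (exp s *\<^sub>R (((\<integral>\<eta>. gain (e + \<eta>) (f s) k \<partial>\<mu>) - fourier (f s) k) - ((\<integral>\<eta>. gain (e + \<eta>) (g s) k \<partial>\<mu>) - fourier (g s) k))
           + exp s *\<^sub>R (fourier (f s) k - fourier (g s) k))) (at s within {0..})"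
        unfolding u_def
        by (intro has_vector_derivative_scaleR has_vector_derivative_diff
              fourier_weak_solution_has_derivative[OF f \<mu> that] fourier_weak_solution_has_derivative[OF g \<mu> that])
           (auto intro!: derivative_eq_intros)
      then show ?thesis by (simp add: Q_def algebra_simps)
    qed
    have \<phi>': "(\<phi> has_vector_derivative \<phi>' s) (at s)" for s
    proof -
      have "((\<lambda>s. (2 * s) ^ Suc n / fact (Suc n)) has_real_derivative real (Suc n) * (2 * s) ^ n * 2 / fact (Suc n)) (at s)"
        by (rule derivative_eq_intros refl | simp)+
      also have "real (Suc n) * (2 * s) ^ n * 2 / fact (Suc n) = 2 * ((2 * s) ^ n / fact n)"
        by (simp add: field_simps del: of_nat_Suc)
      finally have *: "((\<lambda>s. (2 * s) ^ Suc n / fact (Suc n)) has_real_derivative 2 * ((2 * s) ^ n / fact n)) (at s)" .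
      show ?thesis
        unfolding \<phi>_def \<phi>'_def has_real_derivative_iff_has_vector_derivative[symmetric]
        by (intro DERIV_add DERIV_cmult *) (auto intro!: derivative_eq_intros)
    qed
    \<comment> \<open>Dividing the induction hypothesis by \<open>exp s\<close> gives a bound of the form that the contraction
      estimate takes, for all Fourier variables at once.\<close>
    have bound: "norm (exp s *\<^sub>R Q s) \<le> \<phi>' s" if s: "0 \<le> s" "s \<le> t" for s
    proof -
      have "norm (fourier (f s) k - fourier (g s) k) \<le>
          (exp (- s) * d * exp (?a * s)) * norm k powr (2 + \<alpha>) + exp (- s) * (2 * exp T * ((2 * s) ^ n / fact n))" for k
        using Suc.IH[of s k] s Suc.prems by (simp add: exp_minus field_simps)
      then have "norm (Q s) \<le> (exp (- s) * d * exp (?a * s)) * norm k powr (2 + \<alpha>) * ?a +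
          2 * (exp (- s) * (2 * exp T * ((2 * s) ^ n / fact n)))"
        unfolding Q_def using s by (intro norm_mean_gain_diff_le[OF \<mu> e A] prob \<alpha>) auto
      then have "exp s * norm (Q s) \<le> exp s * ((exp (- s) * d * exp (?a * s)) * norm k powr (2 + \<alpha>) * ?a +
          2 * (exp (- s) * (2 * exp T * ((2 * s) ^ n / fact n))))"
        by (intro mult_left_mono) auto
      also have "\<dots> = \<phi>' s"
        by (simp add: \<phi>'_def exp_minus field_simps)
      finally show ?thesis by simp
    qed
    show ?case
    proof (cases "t = 0")
      case True
      then show ?thesis using d[of k] by (simp add: init)
    next
      case False
      have "norm (u t - u 0) \<le> \<phi> t - \<phi> 0"
      proof (rule differentiable_bound_general)
        show "0 < t" using False Suc.prems by simp
        show "continuous_on {0..t} u"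
          unfolding continuous_on_eq_continuous_within
        proof
          fix s assume "s \<in> {0..t}"
          then have "continuous (at s within {0..}) u"
            by (intro has_vector_derivative_continuous[OF u']) simp
          then show "continuous (at s within {0..t}) u"
            by (rule continuous_within_subset) auto
        qed
        show "continuous_on {0..t} \<phi>"
          by (intro continuous_at_imp_continuous_on ballI has_vector_derivative_continuous[OF \<phi>'])
        fix s assume s: "0 < s" "s < t"
        show "(u has_vector_derivative exp s *\<^sub>R Q s) (at s)"
          using u'[of s] s at_within_interior[of s "{0..}"] by simp
        show "(\<phi> has_vector_derivative \<phi>' s) (at s)" by (rule \<phi>')
        show "norm (exp s *\<^sub>R Q s) \<le> \<phi>' s" using s by (intro bound) auto
      qed
      moreover have "norm (u 0) \<le> \<phi> 0"
        using d[of k] by (simp add: u_def \<phi>_def init)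
      moreover have "norm (u t) \<le> norm (u t - u 0) + norm (u 0)"
        using norm_triangle_sub[of "u t" "u 0"] by simp
      ultimately have "norm (u t) \<le> \<phi> t" by linarith
      then show ?thesis by (simp add: u_def \<phi>_def)
    qed
  }
qed

text \<open>The remainder of the Picard iteration vanishes in the limit.\<close>
lemma norm_fourier_diff_le:
  assumes \<mu>: "borel_prob \<mu>" and e: "AE \<eta> in \<mu>. - e \<le> \<eta>" and \<alpha>: "0 < \<alpha>" and A: "frakA \<alpha> e \<mu> < \<infinity>"
    and f: "weak_solution e \<mu> f0 f" and g: "weak_solution e \<mu> g0 g"
    and d: "\<And>k. norm (fourier f0 k - fourier g0 k) \<le> d * norm k powr (2 + \<alpha>)"
    and t: "0 \<le> t"
  shows "norm (fourier (f t) k - fourier (g t) k) \<le> d * exp (- rateC \<alpha> e \<mu> * t) * norm k powr (2 + \<alpha>)"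
proof -
  let ?L = "d * norm k powr (2 + \<alpha>) * exp (enn2real (frakA \<alpha> e \<mu>) * t)"
  have "(\<lambda>n. (2 * t) ^ n / fact n) \<longlonglongrightarrow> 0"
    using summable_LIMSEQ_zero[OF summable_exp[of "2 * t"]] by (simp add: field_simps)
  then have "(\<lambda>n. ?L + 2 * exp t * ((2 * t) ^ n / fact n)) \<longlonglongrightarrow> ?L + 2 * exp t * 0"
    by (intro tendsto_intros)
  then have "exp t * norm (fourier (f t) k - fourier (g t) k) \<le> ?L + 2 * exp t * 0"
    by (rule LIMSEQ_le_const) (use norm_fourier_diff_picard[OF \<mu> e \<alpha> A f g d t order_refl] in auto)
  then have "norm (fourier (f t) k - fourier (g t) k) \<le> exp (- t) * ?L"
    by (simp add: exp_minus field_simps)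
  also have "\<dots> = d * (exp (- t) * exp (enn2real (frakA \<alpha> e \<mu>) * t)) * norm k powr (2 + \<alpha>)"
    by simp
  also have "exp (- t) * exp (enn2real (frakA \<alpha> e \<mu>) * t) = exp (- rateC \<alpha> e \<mu> * t)"
    by (simp add: rateC_def algebra_simps flip: exp_add)
  finally show ?thesis .
qed


theorem theorem5p5:
  fixes e \<alpha> \<beta> :: real and \<mu> :: "real measure"
    and f10 f20 :: "(real^3) measure" and f1 f2 :: "real \<Rightarrow> (real^3) measure"
  assumes "0 \<le> e" "e \<le> 1"
    and "borel_prob \<mu>"
    and "AE \<eta> in \<mu>. - e \<le> \<eta>"
    and "integrable \<mu> (\<lambda>\<eta>. \<eta>)" "(\<integral>\<eta>. \<eta> \<partial>\<mu>) = 0"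
    and "integrable \<mu> (\<lambda>\<eta>. \<eta>\<^sup>2)" "(\<integral>\<eta>. \<eta>\<^sup>2 \<partial>\<mu>) = \<beta>\<^sup>2"
    and "0 < \<alpha>" "frakA \<alpha> e \<mu> < \<infinity>"
    and "weak_solution e \<mu> f10 f1" "weak_solution e \<mu> f20 f2"
    and "equal_moments (2 + nat \<lfloor>\<alpha>\<rfloor>) f10 f20"
  shows "\<forall>t\<ge>0. fourier_dist (2 + \<alpha>) (f1 t) (f2 t) \<le>
           fourier_dist (2 + \<alpha>) f10 f20 * ennreal (exp (- rateC \<alpha> e \<mu> * t))"
proof (intro allI impI)
  fix t :: real assume t: "0 \<le> t"
  show "fourier_dist (2 + \<alpha>) (f1 t) (f2 t) \<le>
           fourier_dist (2 + \<alpha>) f10 f20 * ennreal (exp (- rateC \<alpha> e \<mu> * t))"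
  proof (cases "fourier_dist (2 + \<alpha>) f10 f20 = \<infinity>")
    case True
    then show ?thesis by (simp add: ennreal_top_mult)
  next
    case False
    then obtain d where d: "0 \<le> d" "fourier_dist (2 + \<alpha>) f10 f20 = ennreal d"
      by (metis ennreal_cases infinity_ennreal_def)
    have init: "norm (fourier f10 k - fourier f20 k) \<le> d * norm k powr (2 + \<alpha>)" for k
    proof (cases "k = 0")
      case True
      have "fourier f10 0 = 1" "fourier f20 0 = 1"
        using assms(11,12) by (auto simp: weak_solution_def borel_prob_def fourier_def prob_space.prob_space)
      then show ?thesis using True by simp
    next
      case False
      have "ennreal (norm (fourier f10 k - fourier f20 k) / norm k powr (2 + \<alpha>)) \<le> ennreal d"
        unfolding d(2)[symmetric] fourier_dist_def using False by (intro SUP_upper) auto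
      then show ?thesis using d(1) False by (simp add: field_simps)
    qed
    show ?thesis
      unfolding fourier_dist_def[of _ "f1 t"]
    proof (rule SUP_least)
      fix k :: "real^3" assume "k \<in> UNIV - {0}"
      then have "norm (fourier (f1 t) k - fourier (f2 t) k) / norm k powr (2 + \<alpha>) \<le> d * exp (- rateC \<alpha> e \<mu> * t)"
        using norm_fourier_diff_le[OF assms(3,4,9,10,11,12) init t, of k] by (simp add: field_simps)
      then show "ennreal (norm (fourier (f1 t) k - fourier (f2 t) k) / norm k powr (2 + \<alpha>)) \<le>
          fourier_dist (2 + \<alpha>) f10 f20 * ennreal (exp (- rateC \<alpha> e \<mu> * t))"
        using d by (simp add: ennreal_leI flip: ennreal_mult')
    qed
  qed
qed

end
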